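(* Let $f$ and $g_i$, $i\in I\cup J$, be twice continuously differentiable, let LICQ hold true at every globally optimal solution of problem $(\mathcal{P})$, and suppose that for any globally optimal solution $x_*\in\Omega_*$ the unique KKT-pair $(x_*,\lambda_* )$ satisfies the second order sufficient optimality condition. Then the penalized augmented Lagrangian function $\mathscr{L}_e$ (defined in the context) is globally exact if and only if there exists $c_0>0$ such that the set $$S_e(c_0):=\{(x,\lambda)\in\mathbb{R}^d\times\mathbb{R}^{l+s}\mid\mathscr{L}_e(x,\lambda,c_0)<f_*\}$$ is either bounded or empty. In particular, if there exists $\gamma>0$ such that the set $$\Omega(\gamma,\alpha):=\{x\in\mathbb{R}^d\mid f(x)<f_*+\gamma,\ a(x)>0,\ b(x)>0\}$$ is bounded, then $\mathscr{L}_e$ is globally exact in the sense that its points of global minimum in $(x,\lambda)$ on $\mathbb{R}^d\times\mathbb{R}^{l+s}$ are exactly the KKT-pairs of problem $(\mathcal{P})$ corresponding to globally optimal solutions of this problem, provided $c>0$ is large enough.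
   Context: Problem $(\mathcal{P})$: minimize $f(x)$ over $x\in\mathbb{R}^d$ subject to $g_i(x)\le 0$, $i\in I=\{1,\dots,l\}$, and $g_j(x)=0$, $j\in J=\{l+1,\dots,l+s\}$, where $f,g_i:\mathbb{R}^d\to\mathbb{R}$. A globally optimal solution is assumed to exist; $\Omega_*$ is the set of globally optimal solutions, $f_*$ the optimal value. $L(x,\lambda)=f(x)+\sum_{i=1}^{l+s}\lambda_ig_i(x)$. LICQ at a feasible $x$: the gradients $\nabla g_i(x)$, $i\in I$ with $g_i(x)=0$, and $\nabla g_j(x)$, $j\in J$, are linearly independent. $(x_*,\lambda_* )$ is a KKT-pair if $x_*$ is feasible, $(\lambda_* )_i\ge 0$ and $(\lambda_* )_ig_i(x_* )=0$ for $i\in I$, and $D_xL(x_*,\lambda_* )=0$. It satisfies the second order sufficient optimality condition if $\langle h,D^2_{xx}L(x_*,\lambda_* )h\rangle>0$ for every $h\ne 0$ with $\langle\nabla g_i(x_* ),h\rangle\le 0$ for all $i\in I$ with $g_i(x_* )=0$, $\langle\nabla g_i(x_* ),h\rangle=0$ for all $i\in I$ with $(\lambda_* )_i>0$, and $\langle\nabla g_j(x_* ),h\rangle=0$ for $j\in J$. Fix $\alpha>0$ and $\varkappa>2$ and define $a(x)=\alpha-\sum_{i=1}^l\max\{0,g_i(x)\}^{\varkappa}$, $b(x)=\alpha-\sum_{j=l+1}^{l+s}g_j(x)^2$, $p(x,\lambda)=a(x)/(1+\sum_{i=1}^l\lambda_i^2)$, $q(x,\lambda)=b(x)/(1+\sum_{j=l+1}^{l+s}\lambda_j^2)$,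 $\Omega_\alpha=\{x\in\mathbb{R}^d\mid a(x)>0,\ b(x)>0\}$, $$\eta_1(x,\lambda)=\sum_{i=1}^l\Big(\langle D_xL(x,\lambda),\nabla g_i(x)\rangle+g_i(x)^2\lambda_i\Big)^2+\sum_{j=l+1}^{l+s}\langle D_xL(x,\lambda),\nabla g_j(x)\rangle^2.$$ For $x\in\Omega_\alpha$, $\lambda\in\mathbb{R}^{l+s}$, $c>0$ let $$\mathscr{L}_e(x,\lambda,c)=f(x)+\sum_{i=1}^l\Big(\lambda_im_i+\frac{c}{2p(x,\lambda)}m_i^2\Big)+\sum_{j=l+1}^{l+s}\Big(\lambda_jg_j(x)+\frac{c}{2q(x,\lambda)}g_j(x)^2\Big)+\eta_1(x,\lambda),$$ where $m_i=\max\{g_i(x),-\frac{p(x,\lambda)}{c}\lambda_i\}$, and $\mathscr{L}_e(x,\lambda,c)=+\infty$ for $x\notin\Omega_\alpha$. Globally exact (with respect to $\eta_1$): there is $c_0>0$ such that for any $c\ge c_0$ the function $\mathscr{L}_e(\cdot,\cdot,c)$ attains a global minimum on $\mathbb{R}^d\times\mathbb{R}^{l+s}$, and $(x_*,\lambda_* )$ is a global minimizer if and only if $x_*\in\Omega_*$ and $\eta_1(x_*,\lambda_* )=0$. *)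

theory Defs
  imports "HOL-Analysis.Analysis"
begin

definition gradient :: "(real^'d \<Rightarrow> real) \<Rightarrow> real^'d \<Rightarrow> real^'d" where
  "gradient f x = (\<chi> i. frechet_derivative f (at x) (axis i 1))"

definition hessian :: "(real^'d \<Rightarrow> real) \<Rightarrow> real^'d \<Rightarrow> real^'d^'d" where
  "hessian f x = matrix (frechet_derivative (gradient f) (at x))"

definition twice_cont_diff :: "(real^'d \<Rightarrow> real) \<Rightarrow> bool" where
  "twice_cont_diff f \<longleftrightarrow>
     (\<forall>x. f differentiable (at x)) \<and> (\<forall>x. gradient f differentiable (at x)) \<and>
     continuous_on UNIV (hessian f)"

(* Constraints are indexed by a finite type 'm. The inequality constraints form the set I, the
   equality constraints the set J; one of the two may be empty. In the theorem I and J are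
   assumed to partition 'm, so that multiplier vectors have type real^'m. *)

definition feasible :: "('m \<Rightarrow> real^'d \<Rightarrow> real) \<Rightarrow> 'm set \<Rightarrow> 'm set \<Rightarrow> (real^'d) set" where
  "feasible g I J = {x. (\<forall>i\<in>I. g i x \<le> 0) \<and> (\<forall>j\<in>J. g j x = 0)}"

definition optimal_solutions ::
  "(real^'d \<Rightarrow> real) \<Rightarrow> ('m \<Rightarrow> real^'d \<Rightarrow> real) \<Rightarrow> 'm set \<Rightarrow> 'm set \<Rightarrow> (real^'d) set" where
  "optimal_solutions f g I J = {x \<in> feasible g I J. \<forall>y \<in> feasible g I J. f x \<le> f y}"

(* This is a real infimum, so it is meaningful only if the problem is feasible and f is bounded
   below on the feasible set, as is the case when an optimal solution exists. *)
definition optimal_value ::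
  "(real^'d \<Rightarrow> real) \<Rightarrow> ('m \<Rightarrow> real^'d \<Rightarrow> real) \<Rightarrow> 'm set \<Rightarrow> 'm set \<Rightarrow> real" where
  "optimal_value f g I J = (INF x \<in> feasible g I J. f x)"

definition lagrangian ::
  "(real^'d \<Rightarrow> real) \<Rightarrow> ('m::finite \<Rightarrow> real^'d \<Rightarrow> real) \<Rightarrow> real^'d \<Rightarrow> real^'m \<Rightarrow> real" where
  "lagrangian f g x lam = f x + (\<Sum>i\<in>UNIV. lam $ i * g i x)"

definition grad_lagrangian ::
  "(real^'d \<Rightarrow> real) \<Rightarrow> ('m::finite \<Rightarrow> real^'d \<Rightarrow> real) \<Rightarrow> real^'d \<Rightarrow> real^'m \<Rightarrow> real^'d" where
  "grad_lagrangian f g x lam = gradient (\<lambda>y. lagrangian f g y lam) x"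

definition hess_lagrangian ::
  "(real^'d \<Rightarrow> real) \<Rightarrow> ('m::finite \<Rightarrow> real^'d \<Rightarrow> real) \<Rightarrow> real^'d \<Rightarrow> real^'m \<Rightarrow> real^'d^'d" where
  "hess_lagrangian f g x lam = hessian (\<lambda>y. lagrangian f g y lam) x"

(* Injectivity turns independence of the set of active gradients into independence of the
   indexed family. *)
definition LICQ :: "('m \<Rightarrow> real^'d \<Rightarrow> real) \<Rightarrow> 'm set \<Rightarrow> 'm set \<Rightarrow> real^'d \<Rightarrow> bool" where
  "LICQ g I J x \<longleftrightarrow>
     (let A = {i \<in> I. g i x = 0} \<union> J in
        inj_on (\<lambda>i. gradient (g i) x) A \<and> independent ((\<lambda>i. gradient (g i) x) ` A))"

definition KKT_pair ::
  "(real^'d \<Rightarrow> real) \<Rightarrow> ('m::finite \<Rightarrow> real^'d \<Rightarrow> real) \<Rightarrow> 'm set \<Rightarrow> 'm set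
    \<Rightarrow> real^'d \<Rightarrow> real^'m \<Rightarrow> bool" where
  "KKT_pair f g I J x lam \<longleftrightarrow>
     x \<in> feasible g I J \<and> (\<forall>i\<in>I. lam $ i \<ge> 0 \<and> lam $ i * g i x = 0) \<and> grad_lagrangian f g x lam = 0"

definition second_order_sufficient ::
  "(real^'d \<Rightarrow> real) \<Rightarrow> ('m::finite \<Rightarrow> real^'d \<Rightarrow> real) \<Rightarrow> 'm set \<Rightarrow> 'm set
    \<Rightarrow> real^'d \<Rightarrow> real^'m \<Rightarrow> bool" where
  "second_order_sufficient f g I J x lam \<longleftrightarrow>
     (\<forall>h. h \<noteq> 0 \<and>
          (\<forall>i\<in>I. g i x = 0 \<longrightarrow> gradient (g i) x \<bullet> h \<le> 0) \<and>
          (\<forall>i\<in>I. lam $ i > 0 \<longrightarrow> gradient (g i) x \<bullet> h = 0) \<and>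
          (\<forall>j\<in>J. gradient (g j) x \<bullet> h = 0)
          \<longrightarrow> h \<bullet> (hess_lagrangian f g x lam *v h) > 0)"

definition a_fun ::
  "('m::finite \<Rightarrow> real^'d \<Rightarrow> real) \<Rightarrow> 'm set \<Rightarrow> real \<Rightarrow> real \<Rightarrow> real^'d \<Rightarrow> real" where
  "a_fun g I \<alpha> \<kappa> x = \<alpha> - (\<Sum>i\<in>I. max 0 (g i x) powr \<kappa>)"

definition b_fun ::
  "('m::finite \<Rightarrow> real^'d \<Rightarrow> real) \<Rightarrow> 'm set \<Rightarrow> real \<Rightarrow> real^'d \<Rightarrow> real" where
  "b_fun g J \<alpha> x = \<alpha> - (\<Sum>j\<in>J. (g j x)\<^sup>2)"

definition p_fun ::
  "('m::finite \<Rightarrow> real^'d \<Rightarrow> real) \<Rightarrow> 'm set \<Rightarrow> real \<Rightarrow> real \<Rightarrow> real^'d \<Rightarrow> real^'m \<Rightarrow> real" where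
  "p_fun g I \<alpha> \<kappa> x lam = a_fun g I \<alpha> \<kappa> x / (1 + (\<Sum>i\<in>I. (lam $ i)\<^sup>2))"

definition q_fun ::
  "('m::finite \<Rightarrow> real^'d \<Rightarrow> real) \<Rightarrow> 'm set \<Rightarrow> real \<Rightarrow> real^'d \<Rightarrow> real^'m \<Rightarrow> real" where
  "q_fun g J \<alpha> x lam = b_fun g J \<alpha> x / (1 + (\<Sum>j\<in>J. (lam $ j)\<^sup>2))"

definition Omega_alpha ::
  "('m::finite \<Rightarrow> real^'d \<Rightarrow> real) \<Rightarrow> 'm set \<Rightarrow> 'm set \<Rightarrow> real \<Rightarrow> real \<Rightarrow> (real^'d) set" where
  "Omega_alpha g I J \<alpha> \<kappa> = {x. a_fun g I \<alpha> \<kappa> x > 0 \<and> b_fun g J \<alpha> x > 0}"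

definition eta1 ::
  "(real^'d \<Rightarrow> real) \<Rightarrow> ('m::finite \<Rightarrow> real^'d \<Rightarrow> real) \<Rightarrow> 'm set \<Rightarrow> 'm set
    \<Rightarrow> real^'d \<Rightarrow> real^'m \<Rightarrow> real" where
  "eta1 f g I J x lam =
     (\<Sum>i\<in>I. (grad_lagrangian f g x lam \<bullet> gradient (g i) x + (g i x)\<^sup>2 * lam $ i)\<^sup>2) +
     (\<Sum>j\<in>J. (grad_lagrangian f g x lam \<bullet> gradient (g j) x)\<^sup>2)"

definition m_fun ::
  "('m::finite \<Rightarrow> real^'d \<Rightarrow> real) \<Rightarrow> 'm set \<Rightarrow> real \<Rightarrow> real
    \<Rightarrow> real^'d \<Rightarrow> real^'m \<Rightarrow> real \<Rightarrow> 'm \<Rightarrow> real" where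
  "m_fun g I \<alpha> \<kappa> x lam c i = max (g i x) (- (p_fun g I \<alpha> \<kappa> x lam / c) * lam $ i)"

definition aug_lagrangian ::
  "(real^'d \<Rightarrow> real) \<Rightarrow> ('m::finite \<Rightarrow> real^'d \<Rightarrow> real) \<Rightarrow> 'm set \<Rightarrow> 'm set \<Rightarrow> real \<Rightarrow> real
    \<Rightarrow> real^'d \<Rightarrow> real^'m \<Rightarrow> real \<Rightarrow> ereal" where
  "aug_lagrangian f g I J \<alpha> \<kappa> x lam c =
     (if x \<in> Omega_alpha g I J \<alpha> \<kappa>
      then ereal (f x
        + (\<Sum>i\<in>I. lam $ i * m_fun g I \<alpha> \<kappa> x lam c i
             + c / (2 * p_fun g I \<alpha> \<kappa> x lam) * (m_fun g I \<alpha> \<kappa> x lam c i)\<^sup>2)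
        + (\<Sum>j\<in>J. lam $ j * g j x + c / (2 * q_fun g J \<alpha> x lam) * (g j x)\<^sup>2)
        + eta1 f g I J x lam)
      else \<infinity>)"

definition aug_minimizers ::
  "(real^'d \<Rightarrow> real) \<Rightarrow> ('m::finite \<Rightarrow> real^'d \<Rightarrow> real) \<Rightarrow> 'm set \<Rightarrow> 'm set \<Rightarrow> real \<Rightarrow> real
    \<Rightarrow> real \<Rightarrow> ((real^'d) \<times> (real^'m)) set" where
  "aug_minimizers f g I J \<alpha> \<kappa> c =
     {(x, lam). \<forall>y \<mu>. aug_lagrangian f g I J \<alpha> \<kappa> x lam c \<le> aug_lagrangian f g I J \<alpha> \<kappa> y \<mu> c}"

definition globally_exact ::
  "(real^'d \<Rightarrow> real) \<Rightarrow> ('m::finite \<Rightarrow> real^'d \<Rightarrow> real) \<Rightarrow> 'm set \<Rightarrow> 'm set \<Rightarrow> real \<Rightarrow> real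
    \<Rightarrow> bool" where
  "globally_exact f g I J \<alpha> \<kappa> \<longleftrightarrow>
     (\<exists>c0>0. \<forall>c\<ge>c0.
        aug_minimizers f g I J \<alpha> \<kappa> c \<noteq> {} \<and>
        (\<forall>x lam. (x, lam) \<in> aug_minimizers f g I J \<alpha> \<kappa> c \<longleftrightarrow>
                x \<in> optimal_solutions f g I J \<and> eta1 f g I J x lam = 0))"

definition S_e ::
  "(real^'d \<Rightarrow> real) \<Rightarrow> ('m::finite \<Rightarrow> real^'d \<Rightarrow> real) \<Rightarrow> 'm set \<Rightarrow> 'm set \<Rightarrow> real \<Rightarrow> real
    \<Rightarrow> real \<Rightarrow> ((real^'d) \<times> (real^'m)) set" where
  "S_e f g I J \<alpha> \<kappa> c =
     {(x, lam). aug_lagrangian f g I J \<alpha> \<kappa> x lam c < ereal (optimal_value f g I J)}"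

definition Omega_sublevel ::
  "(real^'d \<Rightarrow> real) \<Rightarrow> ('m::finite \<Rightarrow> real^'d \<Rightarrow> real) \<Rightarrow> 'm set \<Rightarrow> 'm set \<Rightarrow> real \<Rightarrow> real
    \<Rightarrow> real \<Rightarrow> (real^'d) set" where
  "Omega_sublevel f g I J \<gamma> \<alpha> \<kappa> =
     {x. f x < optimal_value f g I J + \<gamma> \<and> a_fun g I \<alpha> \<kappa> x > 0 \<and> b_fun g J \<alpha> x > 0}"

end

(* Each multiplier term of the augmented Lagrangian is the minimum over s >= g_i(x) of
   lam_i s + c/(2p) s^2, so the function is nondecreasing in c, and at every KKT-pair of a globally
   optimal solution it equals f_*. Hence global exactness amounts to S_e(c) being empty for some c.
   Suppose that (x_n, lam_n) lies in S_e(c_n) with c_n -> infinity and x_n bounded. Since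
   p |lam|^2 <= alpha, the penalty terms force a limit point of x_n to be optimal; eta1 is the squared
   norm of an affine map in lam, injective under LICQ, so lam_n is bounded and accumulates at the KKT
   multiplier. Let (h, v) be a limit of the normalised differences to this KKT-pair. Dividing the
   inequality L_e < f_* by the squared distance shows that h is a critical direction with nonpositive
   curvature, so h = 0 by the second order condition; then eta1 forces v = 0, which contradicts
   |(h, v)| = 1. *)

theory Submission
  imports Defs
begin

section \<open>First and second order expansions\<close>

text \<open>The obstacle is that multipliers in \<open>S_e\<close> are unrestricted, while LICQ is
  assumed at optimal solutions only and says nothing at the points \<open>x_n\<close> themselves. So
  bounding the multipliers cannot be the first step. The weights \<open>p\<close> and
  \<open>q\<close> help here: they decay with the squared multipliers, so the linear terms lower the
  function by at most \<open>CARD('m) * (\<alpha> / c)\<close> whatever the multipliers are, and the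
  limit point is seen to be optimal before anything is known about them. Only then does LICQ apply,
  and it does so in the limit. The equation \<open>eta1 = 0\<close> carries no information on signs.
  That its solution at an optimal point is the KKT multiplier follows from uniqueness once a KKT
  multiplier exists, which is why existence is proved separately. Monotonicity in c is used with a
  margin proportional to the sum of squared slacks. An empty \<open>S_e\<close> at one parameter
  only bounds the values from below; at any larger parameter the margin makes all slacks of a
  minimizer vanish, so that it is feasible.\<close>

lemma has_derivative_gradient:
  fixes F :: "real^'n \<Rightarrow> real"
  assumes "F differentiable (at x)"
  shows "(F has_derivative (\<lambda>h. gradient F x \<bullet> h)) (at x)"
proof -
  let ?D = "frechet_derivative F (at x)"
  have D: "(F has_derivative ?D) (at x)"
    using assms frechet_derivative_works by blast
  then have lin: "linear ?D"
    using has_derivative_linear by blast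
  have "?D h = gradient F x \<bullet> h" for h
  proof -
    have "?D h = ?D (\<Sum>i\<in>UNIV. h $ i *\<^sub>R axis i 1)"
      using basis_expansion[of h] by (simp add: scalar_mult_eq_scaleR)
    also have "\<dots> = (\<Sum>i\<in>UNIV. h $ i * ?D (axis i 1))"
      by (simp add: linear_sum[OF lin] linear_scale[OF lin])
    finally show ?thesis
      by (simp add: gradient_def inner_vec_def mult.commute)
  qed
  then show ?thesis
    using D by (metis (no_types, lifting) ext)
qed

lemma gradient_unique:
  fixes F :: "real^'n \<Rightarrow> real"
  assumes "(F has_derivative (\<lambda>h. v \<bullet> h)) (at x)"
  shows "gradient F x = v"
  using frechet_derivative_at[OF assms, symmetric]
  by (simp add: gradient_def vec_eq_iff inner_axis)

lemma hessian_works: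
  fixes F :: "real^'n \<Rightarrow> real"
  assumes "gradient F differentiable (at x)"
  shows "(gradient F has_derivative (\<lambda>h. hessian F x *v h)) (at x)"
proof -
  let ?D = "frechet_derivative (gradient F) (at x)"
  have D: "(gradient F has_derivative ?D) (at x)"
    using assms frechet_derivative_works by blast
  then have "linear ?D"
    using has_derivative_linear by blast
  then have "hessian F x *v h = ?D h" for h
    unfolding hessian_def using fun_cong[OF matrix_vector_mul(2)[of ?D], of h] by simp
  then show ?thesis
    using D by simp
qed

text \<open>The scale \<open>t\<close> is independent of \<open>X n - x\<close> because it will be
  the joint distance in (x, lam); thus \<open>X n = x\<close> may occur, and the limit direction may
  be zero.\<close>

lemma directional_limit:
  fixes F :: "'a::real_normed_vector \<Rightarrow> 'b::real_normed_vector"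
  assumes D: "(F has_derivative F') (at x)"
    and X: "X \<longlonglongrightarrow> x" and t: "\<And>n. t n > (0::real)"
    and h: "(\<lambda>n. (X n - x) /\<^sub>R t n) \<longlonglongrightarrow> h"
  shows "(\<lambda>n. (F (X n) - F x) /\<^sub>R t n) \<longlonglongrightarrow> F' h"
proof -
  interpret F': bounded_linear F'
    using D has_derivative_bounded_linear by blast
  \<comment> \<open>At \<open>y = x\<close> the quotient is 0 by the convention on division by zero,
    which is exactly the value that makes \<open>e\<close> continuous there.\<close>
  define e where "e y = norm (F y - F x - F' (y - x)) / norm (y - x)" for y
  have "(e \<longlongrightarrow> 0) (at x)"
    using D by (simp add: e_def[abs_def] has_derivative_iff_norm)
  then have "isCont e x"
    by (simp add: isCont_def e_def F'.zero)
  then have "(\<lambda>n. e (X n)) \<longlonglongrightarrow> 0"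
    using isCont_tendsto_compose[OF _ X, of e] by (simp add: e_def F'.zero)
  then have "(\<lambda>n. e (X n) * norm ((X n - x) /\<^sub>R t n)) \<longlonglongrightarrow> 0 * norm h"
    by (intro tendsto_intros h)
  moreover have "e (X n) * norm ((X n - x) /\<^sub>R t n)
      = norm ((F (X n) - F x) /\<^sub>R t n - F' ((X n - x) /\<^sub>R t n))" for n
  proof -
    have "(F (X n) - F x) /\<^sub>R t n - F' ((X n - x) /\<^sub>R t n)
        = (F (X n) - F x - F' (X n - x)) /\<^sub>R t n"
      by (simp only: F'.scaleR scaleR_diff_right[of "inverse (t n)" "F (X n) - F x"])
    then show ?thesis
      using t[of n] by (auto simp: e_def F'.zero divide_simps)
  qed
  ultimately have "(\<lambda>n. (F (X n) - F x) /\<^sub>R t n - F' ((X n - x) /\<^sub>R t n)) \<longlonglongrightarrow> 0"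
    by (simp add: tendsto_norm_zero_iff)
  moreover have "(\<lambda>n. F' ((X n - x) /\<^sub>R t n)) \<longlonglongrightarrow> F' h"
    by (intro F'.tendsto h)
  ultimately have "(\<lambda>n. ((F (X n) - F x) /\<^sub>R t n - F' ((X n - x) /\<^sub>R t n))
      + F' ((X n - x) /\<^sub>R t n)) \<longlonglongrightarrow> 0 + F' h"
    by (rule tendsto_add)
  then show ?thesis
    by simp
qed

text \<open>Taylor's formula with Peano remainder, needing the second derivative only at the point
  itself: the mean value theorem passes from \<open>F\<close> to its gradient, which is then
  linearised at \<open>x\<close>.\<close>

lemma second_order_expansion:
  fixes F :: "real^'n \<Rightarrow> real"
  assumes diff: "\<And>y. F differentiable (at y)"
    and H: "(gradient F has_derivative (\<lambda>h. A *v h)) (at x)"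
    and crit: "gradient F x = 0" and "e > 0"
  shows "\<exists>d>0. \<forall>y. norm (y - x) < d \<longrightarrow>
    \<bar>F y - F x - (y - x) \<bullet> (A *v (y - x)) / 2\<bar> \<le> e * (norm (y - x))\<^sup>2"
proof -
  obtain d where "d > 0"
    and d: "\<And>y. norm (y - x) < d \<Longrightarrow>
      norm (gradient F y - gradient F x - A *v (y - x)) \<le> e * norm (y - x)"
    using H \<open>e > 0\<close> unfolding has_derivative_at_alt by blast
  have "\<bar>F y - F x - (y - x) \<bullet> (A *v (y - x)) / 2\<bar> \<le> e * (norm (y - x))\<^sup>2"
    if y: "norm (y - x) < d" for y
  proof -
    define u where "u = y - x"
    \<comment> \<open>With the quadratic part subtracted, the derivative of \<open>\<phi>\<close> is
      the linearisation error of the gradient on the segment, paired with \<open>u\<close>.\<close>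
    define \<phi> where "\<phi> s = F (x + s *\<^sub>R u) - s\<^sup>2 / 2 * (u \<bullet> (A *v u))" for s :: real
    have \<phi>': "(\<phi> has_real_derivative
        (gradient F (x + s *\<^sub>R u) \<bullet> u - s * (u \<bullet> (A *v u)))) (at s)" for s
    proof -
      have "((\<lambda>s. F (x + s *\<^sub>R u)) has_derivative
          (\<lambda>k. gradient F (x + s *\<^sub>R u) \<bullet> (k *\<^sub>R u))) (at s)"
        by (rule has_derivative_compose[OF _ has_derivative_gradient[OF diff]])
          (auto intro!: derivative_eq_intros)
      then have "((\<lambda>s. F (x + s *\<^sub>R u)) has_real_derivative
          (gradient F (x + s *\<^sub>R u) \<bullet> u)) (at s)"
        by (simp add: has_field_derivative_def mult.commute[of _ "gradient F (x + s *\<^sub>R u) \<bullet> u"])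
      moreover have "((\<lambda>s. s\<^sup>2 / 2 * (u \<bullet> (A *v u))) has_real_derivative s * (u \<bullet> (A *v u))) (at s)"
        by (auto intro!: derivative_eq_intros)
      ultimately show ?thesis
        unfolding \<phi>_def by (rule DERIV_diff)
    qed
    obtain s where s: "0 < s" "s < 1"
      and mvt: "\<phi> 1 - \<phi> 0 = gradient F (x + s *\<^sub>R u) \<bullet> u - s * (u \<bullet> (A *v u))"
      using MVT2[of 0 1 \<phi>, OF _ \<phi>'] by auto
    have "norm (s *\<^sub>R u) \<le> norm u"
      using s by (simp add: mult_left_le_one_le)
    then have "norm (gradient F (x + s *\<^sub>R u) - A *v (s *\<^sub>R u)) \<le> e * norm (s *\<^sub>R u)"
      using d[of "x + s *\<^sub>R u"] y by (simp add: u_def crit)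
    also have "\<dots> \<le> e * norm u"
      using \<open>norm (s *\<^sub>R u) \<le> norm u\<close> \<open>e > 0\<close> by simp
    finally have "norm (gradient F (x + s *\<^sub>R u) - A *v (s *\<^sub>R u)) * norm u \<le> e * norm u * norm u"
      by (rule mult_right_mono) simp
    moreover have "\<phi> 1 - \<phi> 0 = (gradient F (x + s *\<^sub>R u) - A *v (s *\<^sub>R u)) \<bullet> u"
      by (simp add: mvt inner_diff_left inner_diff_right inner_commute matrix_vector_mult_scaleR)
    ultimately have "\<bar>\<phi> 1 - \<phi> 0\<bar> \<le> e * norm u * norm u"
      using Cauchy_Schwarz_ineq2 order_trans by metis
    then show ?thesis
      by (simp add: \<phi>_def u_def power2_eq_square mult.assoc)
  qed
  then show ?thesis
    using \<open>d > 0\<close> by blast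
qed

lemma tendsto_imp_norm_bounded:
  fixes X :: "nat \<Rightarrow> 'a::real_normed_vector"
  assumes "X \<longlonglongrightarrow> L"
  obtains B where "\<And>n. norm (X n) \<le> B"
  using convergent_imp_Bseq[OF convergentI[OF assms]] unfolding Bseq_def by blast

lemma second_order_limit:
  fixes F :: "real^'n \<Rightarrow> real"
  assumes diff: "\<And>y. F differentiable (at y)"
    and H: "(gradient F has_derivative (\<lambda>h. A *v h)) (at x)"
    and crit: "gradient F x = 0"
    and X: "X \<longlonglongrightarrow> x" and t: "\<And>n. t n > (0::real)"
    and h: "(\<lambda>n. (X n - x) /\<^sub>R t n) \<longlonglongrightarrow> h"
  shows "(\<lambda>n. (F (X n) - F x) / (t n)\<^sup>2) \<longlonglongrightarrow> h \<bullet> (A *v h) / 2"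
proof -
  define R where "R n = (F (X n) - F x - (X n - x) \<bullet> (A *v (X n - x)) / 2) / (t n)\<^sup>2" for n
  define u where "u n = (X n - x) /\<^sub>R t n" for n
  have u: "u \<longlonglongrightarrow> h"
    using h by (simp add: u_def[abs_def])
  obtain B where "B > 0" and B: "\<And>n. norm (u n) \<le> B"
    using convergent_imp_Bseq[OF convergentI[OF u]] unfolding Bseq_def by blast
  have "R \<longlonglongrightarrow> 0"
  proof (rule LIMSEQ_I)
    fix r :: real assume "r > 0"
    \<comment> \<open>This choice makes the remainder at most \<open>r / 2\<close>, since the
      normalised differences have norm at most \<open>B\<close>.\<close>
    define e where "e = r / (2 * B\<^sup>2)"
    have "e > 0"
      using \<open>r > 0\<close> \<open>B > 0\<close> by (simp add: e_def)
    then obtain d where "d > 0" and d: "\<And>y. norm (y - x) < d \<Longrightarrow>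
        \<bar>F y - F x - (y - x) \<bullet> (A *v (y - x)) / 2\<bar> \<le> e * (norm (y - x))\<^sup>2"
      using second_order_expansion[OF diff H crit] by metis
    obtain N where N: "\<And>n. n \<ge> N \<Longrightarrow> norm (X n - x) < d"
      using LIMSEQ_D[OF X \<open>d > 0\<close>] by blast
    have "norm (R n - 0) < r" if "n \<ge> N" for n
    proof -
      have "\<bar>R n\<bar> \<le> e * (norm (X n - x))\<^sup>2 / (t n)\<^sup>2"
        unfolding R_def using d[OF N[OF that]] by (simp add: divide_right_mono)
      also have "\<dots> = e * (norm (u n))\<^sup>2"
        using t[of n] by (simp add: u_def divide_simps power_mult_distrib)
      also have "\<dots> \<le> e * B\<^sup>2"
        using B[of n] \<open>e > 0\<close> by (simp add: power_mono)
      also have "\<dots> < r"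
        using \<open>r > 0\<close> \<open>B > 0\<close> by (simp add: e_def)
      finally show ?thesis
        by simp
    qed
    then show "\<exists>N. \<forall>n\<ge>N. norm (R n - 0) < r"
      by blast
  qed
  moreover have "(\<lambda>n. u n \<bullet> (A *v u n) / 2) \<longlonglongrightarrow> h \<bullet> (A *v h) / 2"
    by (intro tendsto_intros u bounded_linear.tendsto[OF matrix_vector_mul_bounded_linear]) simp
  ultimately have "(\<lambda>n. R n + u n \<bullet> (A *v u n) / 2) \<longlonglongrightarrow> 0 + h \<bullet> (A *v h) / 2"
    by (rule tendsto_add)
  moreover have "R n + u n \<bullet> (A *v u n) / 2 = (F (X n) - F x) / (t n)\<^sup>2" for n
  proof -
    have "u n \<bullet> (A *v u n) = (X n - x) \<bullet> (A *v (X n - x)) / (t n)\<^sup>2"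
      by (simp only: u_def matrix_vector_mult_scaleR inner_scaleR_left inner_scaleR_right)
        (simp add: divide_inverse power2_eq_square)
    then show ?thesis
      by (simp add: R_def diff_divide_distrib)
  qed
  ultimately show ?thesis
    by simp
qed

section \<open>Boundedness from an injective limit map, and the consequence of LICQ\<close>

text \<open>Otherwise vectors of growing norm, normalised, would have a unit limit point
  \<open>v\<close>; dividing the bound \<open>B\<close> by the norms gives \<open>S v = 0\<close>.
  It bounds multipliers from bounded residuals when injectivity is known only at the limit
  point.\<close>

lemma bounded_preimage_injective_limit:
  fixes T :: "nat \<Rightarrow> 'a::euclidean_space \<Rightarrow> 'b::real_normed_vector"
  assumes scale: "\<And>n r v. T n (r *\<^sub>R v) = r *\<^sub>R T n v"
    and conv: "\<And>r v w. strict_mono (r :: nat \<Rightarrow> nat) \<Longrightarrow> w \<longlonglongrightarrow> v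
      \<Longrightarrow> (\<lambda>n. T (r n) (w n)) \<longlonglongrightarrow> S v"
    and inj: "\<And>v. S v = 0 \<Longrightarrow> v = 0"
    and bnd: "\<And>n. norm (T n (y n)) \<le> B"
  shows "bounded (range y)"
proof (rule ccontr)
  assume unb: "\<not> bounded (range y)"
  \<comment> \<open>Finitely many initial terms are bounded, so large norms occur beyond every
    index; this lets the selected indices increase.\<close>
  have "\<exists>n>N. norm (y n) > real k" for N k
  proof (rule ccontr)
    assume "\<not> ?thesis"
    then have "norm (y n) \<le> (\<Sum>i\<le>N. norm (y i)) + real k" for n
    proof (cases "n \<le> N")
      case True
      then have "norm (y n) \<le> (\<Sum>i\<le>N. norm (y i))"
        by (intro member_le_sum) auto
      then show ?thesis by simp
    next
      case False
      then have "norm (y n) \<le> real k"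
        using \<open>\<not> (\<exists>n>N. norm (y n) > real k)\<close> by (meson not_le)
      then show ?thesis
        by (simp add: add_increasing sum_nonneg)
    qed
    then show False
      using unb by (auto simp: bounded_iff)
  qed
  then obtain s where s: "\<And>N k. s N k > N" "\<And>N k. norm (y (s N k)) > real k"
    by metis
  \<comment> \<open>The offsets keep the norm at \<open>r n\<close> above \<open>n + 1\<close>,
    hence positive already at \<open>n = 0\<close>, so that normalising is legitimate.\<close>
  define r where "r = rec_nat (s 0 1) (\<lambda>n q. s q (n + 2))"
  have r: "r 0 = s 0 1" "\<And>n. r (Suc n) = s (r n) (n + 2)"
    by (simp_all add: r_def)
  have "strict_mono r"
    by (rule strict_monoI_Suc) (simp only: r s(1))
  have big: "norm (y (r n)) > real (n + 1)" for n
    using s(2)[of "n + 1"] by (cases n) (simp_all add: r(1)[simplified] r(2)[simplified])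
  define w where "w n = y (r n) /\<^sub>R norm (y (r n))" for n
  have nz: "norm (y (r n)) > 0" for n
    using big[of n] by linarith
  then have "w n \<in> sphere 0 1" for n
    by (simp add: w_def less_imp_neq[symmetric])
  then obtain v q where v: "v \<in> sphere 0 1" and "strict_mono (q :: nat \<Rightarrow> nat)"
    and q: "(w \<circ> q) \<longlonglongrightarrow> v"
    using compact_sphere[of "0::'a" 1] unfolding compact_def by metis
  have "(\<lambda>n. T ((r \<circ> q) n) ((w \<circ> q) n)) \<longlonglongrightarrow> S v"
    by (rule conv[OF strict_mono_o[OF \<open>strict_mono r\<close> \<open>strict_mono q\<close>] q])
  moreover have "(\<lambda>n. T ((r \<circ> q) n) ((w \<circ> q) n)) \<longlonglongrightarrow> 0"
  proof (rule Lim_null_comparison)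
    show "\<forall>\<^sub>F n in sequentially. norm (T ((r \<circ> q) n) ((w \<circ> q) n)) \<le> B * inverse (real (Suc n))"
    proof (intro always_eventually allI)
      fix n
      have "B \<ge> 0"
        using bnd[of 0] norm_ge_zero order_trans by blast
      have "real (Suc n) \<le> norm (y (r (q n)))"
        using big[of "q n"] seq_suble[OF \<open>strict_mono q\<close>, of n] by linarith
      then have "inverse (norm (y (r (q n)))) \<le> inverse (real (Suc n))"
        by (intro le_imp_inverse_le) auto
      then have "norm (T (r (q n)) (y (r (q n)))) * inverse (norm (y (r (q n))))
          \<le> B * inverse (real (Suc n))"
        using bnd \<open>B \<ge> 0\<close> by (intro mult_mono) auto
      then show "norm (T ((r \<circ> q) n) ((w \<circ> q) n)) \<le> B * inverse (real (Suc n))"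
        by (simp add: w_def scale mult.commute)
    qed
    show "(\<lambda>n. B * inverse (real (Suc n))) \<longlonglongrightarrow> 0"
      using tendsto_mult_right_zero[OF LIMSEQ_inverse_real_of_nat] by blast
  qed
  ultimately have "S v = 0"
    by (rule LIMSEQ_unique)
  then show False
    using inj v by fastforce
qed

text \<open>Complementarity makes \<open>v\<close> vanish off the active set, and on the active set
  the gradients are independent.\<close>

lemma LICQ_injective:
  fixes g :: "'m::finite \<Rightarrow> real^'d \<Rightarrow> real"
  assumes licq: "LICQ g I J x" and "I \<union> J = UNIV"
    and sum0: "(\<Sum>i\<in>UNIV. v $ i *\<^sub>R gradient (g i) x) = 0"
    and compl: "\<And>i. i \<in> I \<Longrightarrow> g i x * v $ i = 0"
  shows "v = (0 :: real^'m)"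
proof -
  define A where "A = {i \<in> I. g i x = 0} \<union> J"
  define G where "G = (\<lambda>i. gradient (g i) x)"
  have inj: "inj_on G A" and ind: "independent (G ` A)"
    using licq by (auto simp: LICQ_def A_def G_def Let_def)
  have off: "v $ i = 0" if "i \<notin> A" for i
    using that compl[of i] \<open>I \<union> J = UNIV\<close> by (auto simp: A_def)
  \<comment> \<open>Independence speaks of a set of vectors, so the coefficients are carried from
    indices to vectors by inverting \<open>G\<close> on \<open>A\<close>.\<close>
  have "(\<Sum>b\<in>G ` A. v $ the_inv_into A G b *\<^sub>R b) = (\<Sum>i\<in>A. v $ i *\<^sub>R G i)"
    using inj by (simp add: sum.reindex the_inv_into_f_f)
  also have "\<dots> = (\<Sum>i\<in>UNIV. v $ i *\<^sub>R G i)"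
    using off by (intro sum.mono_neutral_left) auto
  finally have sum: "(\<Sum>b\<in>G ` A. v $ the_inv_into A G b *\<^sub>R b) = 0"
    using sum0 by (simp add: G_def)
  have "v $ i = 0" if "i \<in> A" for i
    using independentD[OF ind _ order_refl sum, of "G i"] that inj by (simp add: the_inv_into_f_f)
  then show ?thesis
    using off by (auto simp: vec_eq_iff)
qed

text \<open>Half of the quadratic term completes the square with the linear one; the other half is
  kept. The number \<open>d\<close> will be a multiplier, or its deviation from the KKT
  multiplier.\<close>

lemma quadratic_lower_bound:
  fixes c P d s :: real
  assumes "c > 0" "P > 0"
  shows "c / (4 * P) * s\<^sup>2 - P * d\<^sup>2 / c \<le> d * s + c / (2 * P) * s\<^sup>2"
proof -
  have "0 \<le> c / (4 * P) * (s + 2 * P * d / c)\<^sup>2"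
    using assms by simp
  also have "\<dots> = d * s + c / (2 * P) * s\<^sup>2 - (c / (4 * P) * s\<^sup>2 - P * d\<^sup>2 / c)"
    using assms by (simp add: field_simps power2_eq_square)
  finally show ?thesis
    by simp
qed

lemma norm_vec_power2: "(norm v)\<^sup>2 = (\<Sum>i\<in>UNIV. (v $ i)\<^sup>2)" for v :: "real^'n"
  unfolding power2_norm_eq_inner inner_vec_def by (simp add: power2_eq_square)

text \<open>Squaring removes the kink at 0, where the difference quotient is bounded by the
  increment. This makes the quadratic penalty for inequalities differentiable.\<close>

lemma has_real_derivative_max_0_squared:
  "((\<lambda>t. (max 0 t)\<^sup>2) has_real_derivative 2 * max 0 t) (at t)" for t :: real
proof -
  have "((\<lambda>t. (max 0 t)\<^sup>2) has_real_derivative 2 * max 0 t) (at t)" if "t > 0" for t :: real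
  proof (rule has_field_derivative_transform_within_open[where S = "{0<..}" and f = "\<lambda>t. t\<^sup>2"])
    show "((\<lambda>t. t\<^sup>2) has_real_derivative 2 * max 0 t) (at t)"
      using that by (auto intro!: derivative_eq_intros)
  qed (use that in auto)
  moreover have "((\<lambda>t. (max 0 t)\<^sup>2) has_real_derivative 2 * max 0 t) (at t)" if "t < 0" for t :: real
  proof (rule has_field_derivative_transform_within_open[where S = "{..<0}" and f = "\<lambda>t. 0"])
    show "((\<lambda>t. 0) has_real_derivative 2 * max 0 t) (at t)"
      using that by simp
  qed (use that in auto)
  moreover have "((\<lambda>t. (max 0 t)\<^sup>2) has_real_derivative 2 * max 0 0) (at (0::real))"
  proof -
    have "((\<lambda>h. ((max 0 (0 + h))\<^sup>2 - (max 0 (0::real))\<^sup>2) / h) \<longlongrightarrow> 0) (at 0)"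
    proof (rule Lim_null_comparison)
      show "\<forall>\<^sub>F h in at 0. norm (((max 0 (0 + h))\<^sup>2 - (max 0 (0::real))\<^sup>2) / h) \<le> \<bar>h\<bar>"
        by (auto simp: eventually_at_filter max_def power2_eq_square)
      show "((\<lambda>h. \<bar>h\<bar>) \<longlongrightarrow> 0) (at (0::real))"
        by (auto intro!: tendsto_eq_intros)
    qed
    then show ?thesis
      by (simp add: DERIV_def)
  qed
  ultimately show ?thesis
    by (cases t "0::real" rule: linorder_cases) auto
qed

section \<open>The augmented Lagrangian\<close>

locale nonlinear_program =
  fixes f :: "real^'d \<Rightarrow> real"
    and g :: "'m::finite \<Rightarrow> real^'d \<Rightarrow> real"
    and I J :: "'m set"
    and \<alpha> \<kappa> :: real
  assumes partition: "I \<union> J = UNIV" "I \<inter> J = {}"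
    and alpha_pos: "\<alpha> > 0"
    and smooth_f: "twice_cont_diff f"
    and smooth_g: "\<And>i. twice_cont_diff (g i)"
begin

abbreviation G :: "'m \<Rightarrow> real^'d \<Rightarrow> real^'d" where
  "G i \<equiv> gradient (g i)"

abbreviation \<Omega> :: "(real^'d) set" where
  "\<Omega> \<equiv> Omega_alpha g I J \<alpha> \<kappa>"

abbreviation \<eta> :: "real^'d \<Rightarrow> real^'m \<Rightarrow> real" where
  "\<eta> \<equiv> eta1 f g I J"

lemma sum_split: "(\<Sum>i\<in>UNIV. F i) = (\<Sum>i\<in>I. F i) + (\<Sum>j\<in>J. F j)"
  using sum.union_disjoint[of I J F] partition by (simp add: finite_subset[OF subset_UNIV])

lemma notin_I_iff: "i \<notin> I \<longleftrightarrow> i \<in> J"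
  using partition by auto

lemma f_deriv: "(f has_derivative (\<lambda>h. gradient f x \<bullet> h)) (at x)"
  and g_deriv: "(g i has_derivative (\<lambda>h. G i x \<bullet> h)) (at x)"
  using smooth_f smooth_g by (simp_all add: twice_cont_diff_def has_derivative_gradient)

lemma isCont_f: "isCont f x" and isCont_g: "isCont (g i) x"
  using f_deriv g_deriv has_derivative_continuous by blast+

lemma isCont_gradient_f: "isCont (gradient f) x" and isCont_G: "isCont (G i) x"
  using smooth_f smooth_g differentiable_imp_continuous_within
  unfolding twice_cont_diff_def by blast+

lemmas tendsto_f = isCont_tendsto_compose[OF isCont_f]
lemmas tendsto_g = isCont_tendsto_compose[OF isCont_g]
lemmas tendsto_gradient_f = isCont_tendsto_compose[OF isCont_gradient_f]
lemmas tendsto_G = isCont_tendsto_compose[OF isCont_G]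

lemma lagrangian_deriv:
  "((\<lambda>y. lagrangian f g y lam) has_derivative
    (\<lambda>h. (gradient f x + (\<Sum>i\<in>UNIV. lam $ i *\<^sub>R G i x)) \<bullet> h)) (at x)"
  unfolding lagrangian_def
  by (auto intro!: derivative_eq_intros f_deriv g_deriv
      simp: inner_add_left inner_sum_left)

lemma grad_lagrangian_eq:
  "grad_lagrangian f g x lam = gradient f x + (\<Sum>i\<in>UNIV. lam $ i *\<^sub>R G i x)"
  unfolding grad_lagrangian_def by (rule gradient_unique[OF lagrangian_deriv])

lemma hess_lagrangian_works:
  "(gradient (\<lambda>y. lagrangian f g y lam) has_derivative (\<lambda>h. hess_lagrangian f g x lam *v h)) (at x)"
  unfolding hess_lagrangian_def
proof (rule hessian_works)
  have "gradient (\<lambda>y. lagrangian f g y lam) = (\<lambda>x. gradient f x + (\<Sum>i\<in>UNIV. lam $ i *\<^sub>R G i x))"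
    using grad_lagrangian_eq by (auto simp: grad_lagrangian_def)
  then show "gradient (\<lambda>y. lagrangian f g y lam) differentiable (at x)"
    using smooth_f smooth_g by (auto simp: twice_cont_diff_def)
qed

section \<open>The linear map in the multipliers behind \<open>eta1\<close>\<close>

definition ineq_flag :: "'m \<Rightarrow> real" where
  "ineq_flag i = (if i \<in> I then 1 else 0)"

text \<open>The Gram matrix of the constraint gradients plus the diagonal of squared inequality
  values, applied to \<open>v\<close>. It is the linear part in the multiplier of the residual whose
  squared norm is \<open>eta1\<close>.\<close>

definition mult_map :: "real^'d \<Rightarrow> real^'m \<Rightarrow> real^'m" where
  "mult_map x v = (\<chi> i. (\<Sum>j\<in>UNIV. v $ j *\<^sub>R G j x) \<bullet> G i x + ineq_flag i * (g i x)\<^sup>2 * v $ i)"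

lemma mult_map_scaleR: "mult_map x (r *\<^sub>R v) = r *\<^sub>R mult_map x v"
proof -
  have "(\<Sum>j\<in>UNIV. (r *\<^sub>R v) $ j *\<^sub>R G j x) = r *\<^sub>R (\<Sum>j\<in>UNIV. v $ j *\<^sub>R G j x)"
    by (simp add: scaleR_sum_right)
  then show ?thesis
    unfolding mult_map_def by (subst vec_eq_iff) (simp add: distrib_left mult.left_commute)
qed

lemma mult_map_diff: "mult_map x (v - w) = mult_map x v - mult_map x w"
proof -
  have "(\<Sum>j\<in>UNIV. (v - w) $ j *\<^sub>R G j x) = (\<Sum>j\<in>UNIV. v $ j *\<^sub>R G j x) - (\<Sum>j\<in>UNIV. w $ j *\<^sub>R G j x)"
    by (simp add: scaleR_diff_left sum_subtractf)
  then have "(\<Sum>j\<in>UNIV. (v - w) $ j *\<^sub>R G j x) \<bullet> y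
      = (\<Sum>j\<in>UNIV. v $ j *\<^sub>R G j x) \<bullet> y - (\<Sum>j\<in>UNIV. w $ j *\<^sub>R G j x) \<bullet> y" for y
    by (simp only: inner_diff_left)
  then show ?thesis
    unfolding mult_map_def by (subst vec_eq_iff) (simp only: vec_lambda_beta vector_minus_component,
      simp add: algebra_simps)
qed

lemma tendsto_mult_map:
  assumes "X \<longlonglongrightarrow> x" "V \<longlonglongrightarrow> v"
  shows "(\<lambda>n. mult_map (X n) (V n)) \<longlonglongrightarrow> mult_map x v"
  unfolding mult_map_def
  by (intro tendsto_intros tendsto_vec_lambda tendsto_g tendsto_G assms)

text \<open>Pairing the image with \<open>v\<close> yields a sum of two nonnegative quantities: the
  squared norm of the gradient combination and the squares of the complementarity products. Both
  vanish, which is the situation of \<open>LICQ_injective\<close>.\<close>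

lemma mult_map_injective:
  assumes "LICQ g I J x" "mult_map x v = 0"
  shows "v = 0"
proof -
  define S where "S = (\<Sum>j\<in>UNIV. v $ j *\<^sub>R G j x)"
  have "0 = v \<bullet> mult_map x v"
    using assms by simp
  also have "\<dots> = (\<Sum>i\<in>UNIV. S \<bullet> (v $ i *\<^sub>R G i x)) + (\<Sum>i\<in>UNIV. ineq_flag i * (g i x * v $ i)\<^sup>2)"
    unfolding inner_vec_def[of v]
    by (simp add: mult_map_def S_def[symmetric] algebra_simps power2_eq_square sum.distrib)
  also have "(\<Sum>i\<in>UNIV. S \<bullet> (v $ i *\<^sub>R G i x)) = S \<bullet> S"
    by (simp only: inner_sum_right[symmetric]) (simp add: S_def)
  finally have sum: "S \<bullet> S + (\<Sum>i\<in>UNIV. ineq_flag i * (g i x * v $ i)\<^sup>2) = 0"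
    by simp
  have nn: "(\<Sum>i\<in>UNIV. ineq_flag i * (g i x * v $ i)\<^sup>2) \<ge> 0"
    by (intro sum_nonneg) (auto simp: ineq_flag_def)
  then have "S = 0" and "(\<Sum>i\<in>UNIV. ineq_flag i * (g i x * v $ i)\<^sup>2) = 0"
    using sum inner_ge_zero[of S] by (auto simp: add_nonneg_eq_0_iff)
  have "ineq_flag i * (g i x * v $ i)\<^sup>2 = 0" for i
    using sum_nonneg_0[OF _ _ \<open>(\<Sum>i\<in>UNIV. ineq_flag i * (g i x * v $ i)\<^sup>2) = 0\<close>, of i]
    by (auto simp: ineq_flag_def)
  then have "g i x * v $ i = 0" if "i \<in> I" for i
    using that by (metis ineq_flag_def mult_1 power_eq_0_iff)
  then show ?thesis
    using LICQ_injective[OF assms(1) partition(1)] \<open>S = 0\<close> by (simp add: S_def)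
qed

lemma eta1_sum:
  "\<eta> x lam = (\<Sum>i\<in>UNIV. (grad_lagrangian f g x lam \<bullet> G i x + ineq_flag i * (g i x)\<^sup>2 * lam $ i)\<^sup>2)"
  by (simp add: sum_split eta1_def ineq_flag_def notin_I_iff[symmetric] cong: sum.cong)
    (intro sum.cong, auto simp: notin_I_iff[symmetric])

lemma eta1_eq_norm: "\<eta> x lam = (norm ((\<chi> i. gradient f x \<bullet> G i x) + mult_map x lam))\<^sup>2"
  by (simp add: eta1_sum norm_vec_power2 mult_map_def grad_lagrangian_eq inner_add_left add.assoc)

lemma eta1_nonneg: "\<eta> x lam \<ge> 0"
  by (simp add: eta1_eq_norm)

lemma tendsto_eta1:
  assumes "X \<longlonglongrightarrow> x" "V \<longlonglongrightarrow> v"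
  shows "(\<lambda>n. \<eta> (X n) (V n)) \<longlonglongrightarrow> \<eta> x v"
  unfolding eta1_eq_norm
  by (intro tendsto_intros tendsto_vec_lambda tendsto_gradient_f tendsto_G tendsto_mult_map assms)

lemma KKT_pair_eta1: "KKT_pair f g I J x lam \<Longrightarrow> \<eta> x lam = 0"
  by (auto simp: KKT_pair_def eta1_def intro!: sum.neutral)

text \<open>At an optimal point this identifies any zero of \<open>eta1\<close> with the KKT
  multiplier, whose signs and complementarity are then inherited.\<close>

lemma eta1_zero_unique:
  assumes "LICQ g I J x" "\<eta> x lam = 0" "\<eta> x \<mu> = 0"
  shows "lam = \<mu>"
proof -
  have "(\<chi> i. gradient f x \<bullet> G i x) + mult_map x lam = (\<chi> i. gradient f x \<bullet> G i x) + mult_map x \<mu>"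
    using assms(2,3) by (simp add: eta1_eq_norm)
  then have "mult_map x (lam - \<mu>) = 0"
    by (simp add: mult_map_diff)
  then show ?thesis
    using mult_map_injective[OF assms(1)] by fastforce
qed

section \<open>Termwise form of the augmented Lagrangian and its bounds\<close>

definition slack :: "real^'d \<Rightarrow> real^'m \<Rightarrow> real \<Rightarrow> 'm \<Rightarrow> real" where
  "slack x lam c i = (if i \<in> I then m_fun g I \<alpha> \<kappa> x lam c i else g i x)"

definition scaling :: "real^'d \<Rightarrow> real^'m \<Rightarrow> 'm \<Rightarrow> real" where
  "scaling x lam i = (if i \<in> I then p_fun g I \<alpha> \<kappa> x lam else q_fun g J \<alpha> x lam)"

definition penalty_term :: "real^'d \<Rightarrow> real^'m \<Rightarrow> real \<Rightarrow> 'm \<Rightarrow> real \<Rightarrow> real" where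
  "penalty_term x lam c i s = lam $ i * s + c / (2 * scaling x lam i) * s\<^sup>2"

text \<open>The real-valued formula, meaningful as the augmented Lagrangian on
  \<open>\<Omega>\<close>; the infinite value elsewhere is dealt with once, in
  \<open>aug_lagrangian_eq\<close>.\<close>

definition AL :: "real^'d \<Rightarrow> real^'m \<Rightarrow> real \<Rightarrow> real" where
  "AL x lam c = f x + (\<Sum>i\<in>UNIV. penalty_term x lam c i (slack x lam c i)) + \<eta> x lam"

lemma aug_lagrangian_eq:
  "aug_lagrangian f g I J \<alpha> \<kappa> x lam c = (if x \<in> \<Omega> then ereal (AL x lam c) else \<infinity>)"
proof -
  have "(\<Sum>j\<in>J. penalty_term x lam c j (slack x lam c j)) =
      (\<Sum>j\<in>J. lam $ j * g j x + c / (2 * q_fun g J \<alpha> x lam) * (g j x)\<^sup>2)"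
    by (intro sum.cong) (auto simp: penalty_term_def slack_def scaling_def notin_I_iff[symmetric])
  moreover have "(\<Sum>i\<in>I. penalty_term x lam c i (slack x lam c i)) =
      (\<Sum>i\<in>I. lam $ i * m_fun g I \<alpha> \<kappa> x lam c i
         + c / (2 * p_fun g I \<alpha> \<kappa> x lam) * (m_fun g I \<alpha> \<kappa> x lam c i)\<^sup>2)"
    by (intro sum.cong) (auto simp: penalty_term_def slack_def scaling_def)
  ultimately show ?thesis
    by (simp add: aug_lagrangian_def AL_def sum_split add.assoc)
qed

text \<open>The third bound is the purpose of the denominators of \<open>p\<close> and
  \<open>q\<close>: a single squared multiplier is below the denominator, and the numerator is at
  most \<open>\<alpha>\<close>. All later estimates uniform in the multiplier rest on it.\<close>

lemma scaling_bounds: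
  assumes "x \<in> \<Omega>"
  shows "scaling x lam i > 0" "scaling x lam i \<le> \<alpha>" "scaling x lam i * (lam $ i)\<^sup>2 \<le> \<alpha>"
proof -
  define K where "K = (if i \<in> I then I else J)"
  define w where "w = (if i \<in> I then a_fun g I \<alpha> \<kappa> x else b_fun g J \<alpha> x)"
  define S where "S = (\<Sum>k\<in>K. (lam $ k)\<^sup>2)"
  have sc: "scaling x lam i = w / (1 + S)"
    by (simp add: scaling_def p_fun_def q_fun_def w_def S_def K_def)
  have "w > 0"
    using assms by (simp add: Omega_alpha_def w_def)
  have "w \<le> \<alpha>"
    by (simp add: w_def a_fun_def b_fun_def sum_nonneg)
  have "S \<ge> 0"
    by (simp add: S_def sum_nonneg)
  have "i \<in> K"
    using notin_I_iff by (simp add: K_def)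
  then have "(lam $ i)\<^sup>2 \<le> S"
    unfolding S_def by (intro member_le_sum) (auto simp: finite_subset[OF subset_UNIV])
  show "scaling x lam i > 0"
    using \<open>w > 0\<close> \<open>S \<ge> 0\<close> by (simp add: sc)
  have "w / (1 + S) \<le> w"
    using \<open>w > 0\<close> \<open>S \<ge> 0\<close> by (simp add: divide_le_eq)
  then show "scaling x lam i \<le> \<alpha>"
    using \<open>w \<le> \<alpha>\<close> by (simp add: sc)
  have "w * (lam $ i)\<^sup>2 \<le> w * (1 + S)"
    using \<open>(lam $ i)\<^sup>2 \<le> S\<close> \<open>w > 0\<close> by (intro mult_left_mono) auto
  then have "scaling x lam i * (lam $ i)\<^sup>2 \<le> w"
    using \<open>S \<ge> 0\<close> by (simp add: sc divide_le_eq)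
  then show "scaling x lam i * (lam $ i)\<^sup>2 \<le> \<alpha>"
    using \<open>w \<le> \<alpha>\<close> by linarith
qed

lemma slack_ge: "g i x \<le> slack x lam c i"
  and slack_eq: "i \<notin> I \<Longrightarrow> slack x lam c i = g i x"
  by (simp_all add: slack_def m_fun_def)

text \<open>For an inequality, \<open>slack\<close> is the projection of the vertex
  \<open>- (P / c) * lam $ i\<close> of a convex parabola onto the half-line above
  \<open>g i x\<close>.\<close>

lemma slack_minimizes:
  assumes "x \<in> \<Omega>" "c > 0" "g i x \<le> s" "i \<notin> I \<Longrightarrow> s = g i x"
  shows "penalty_term x lam c i (slack x lam c i) \<le> penalty_term x lam c i s"
proof (cases "i \<in> I")
  case True
  define P where "P = scaling x lam i"
  define m where "m = slack x lam c i"
  have "P > 0"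
    using scaling_bounds[OF assms(1)] by (simp add: P_def)
  have m: "m = max (g i x) (- (P / c) * lam $ i)"
    using True by (simp add: m_def slack_def m_fun_def P_def scaling_def)
  \<comment> \<open>The second factor is the derivative of the parabola at the midpoint of
    \<open>s\<close> and \<open>m\<close>, so its sign depends on the side of the vertex on which
    the midpoint lies.\<close>
  have diff: "penalty_term x lam c i s - penalty_term x lam c i m
      = (s - m) * (lam $ i + c / (2 * P) * (s + m))"
    by (simp add: penalty_term_def P_def algebra_simps power2_eq_square diff_divide_distrib)
  have "0 \<le> (s - m) * (lam $ i + c / (2 * P) * (s + m))"
  proof (cases "s \<ge> m")
    case True
    have "- (P / c) * lam $ i \<le> m"
      by (simp add: m)
    then have "- (P / c) * lam $ i \<le> (s + m) / 2"
      using True by argo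
    then have "c / P * (- (P / c) * lam $ i) \<le> c / P * ((s + m) / 2)"
      using \<open>P > 0\<close> \<open>c > 0\<close> by (intro mult_left_mono) auto
    then have "0 \<le> lam $ i + c / (2 * P) * (s + m)"
      using \<open>P > 0\<close> \<open>c > 0\<close> by (simp add: field_simps)
    then show ?thesis
      using True by simp
  next
    case False
    \<comment> \<open>Here \<open>g i x \<le> s < m\<close>, so the maximum defining
      \<open>m\<close> is attained by the vertex.\<close>
    then have "m = - (P / c) * lam $ i"
      using assms(3) m by linarith
    then have "(s + m) / 2 \<le> - (P / c) * lam $ i"
      using False by argo
    then have "c / P * ((s + m) / 2) \<le> c / P * (- (P / c) * lam $ i)"
      using \<open>P > 0\<close> \<open>c > 0\<close> by (intro mult_left_mono) auto
    then have "lam $ i + c / (2 * P) * (s + m) \<le> 0"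
      using \<open>P > 0\<close> \<open>c > 0\<close> by (simp add: field_simps)
    then show ?thesis
      using False by (simp add: mult_nonpos_nonpos)
  qed
  then show ?thesis
    using diff by (simp add: m_def)
qed (use assms slack_eq in simp)

text \<open>The slack for the larger parameter is an admissible competitor for the smaller one, and
  the two penalties at it differ by \<open>(c - c') / (2 * P)\<close> times its square, with
  \<open>P\<close> at most \<open>\<alpha>\<close>.\<close>

lemma AL_mono:
  assumes x: "x \<in> \<Omega>" and c: "0 < c'" "c' \<le> c"
  shows "AL x lam c' + (c - c') / (2 * \<alpha>) * (\<Sum>i\<in>UNIV. (slack x lam c i)\<^sup>2) \<le> AL x lam c"
proof -
  have "penalty_term x lam c' i (slack x lam c' i) + (c - c') / (2 * \<alpha>) * (slack x lam c i)\<^sup>2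
      \<le> penalty_term x lam c i (slack x lam c i)" for i
  proof -
    define s where "s = slack x lam c i"
    define P where "P = scaling x lam i"
    have P: "0 < P" "P \<le> \<alpha>"
      using scaling_bounds[OF x] by (simp_all add: P_def)
    have "penalty_term x lam c' i (slack x lam c' i) \<le> penalty_term x lam c' i s"
      using x c by (intro slack_minimizes) (simp_all add: s_def slack_ge slack_eq)
    also have "\<dots> = penalty_term x lam c i s - (c - c') / (2 * P) * s\<^sup>2"
      by (simp add: penalty_term_def P_def[symmetric] diff_divide_distrib algebra_simps)
    also have "\<dots> \<le> penalty_term x lam c i s - (c - c') / (2 * \<alpha>) * s\<^sup>2"
      using P c by (intro diff_left_mono mult_right_mono divide_left_mono) auto
    finally show ?thesis
      by (simp add: s_def)
  qed
  then have "(\<Sum>i\<in>UNIV. penalty_term x lam c' i (slack x lam c' i) + (c - c') / (2 * \<alpha>) * (slack x lam c i)\<^sup>2)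
      \<le> (\<Sum>i\<in>UNIV. penalty_term x lam c i (slack x lam c i))"
    by (rule sum_mono)
  then show ?thesis
    by (simp add: AL_def sum.distrib sum_distrib_left)
qed

text \<open>\<open>quadratic_lower_bound\<close> with the multiplier itself as \<open>d\<close>: by
  \<open>scaling_bounds\<close> each index loses at most \<open>\<alpha> / c\<close>, independently
  of the multiplier.\<close>

lemma AL_lower_bound:
  assumes x: "x \<in> \<Omega>" and c: "c > 0"
  shows "f x + \<eta> x lam + c / (4 * \<alpha>) * (\<Sum>i\<in>UNIV. (slack x lam c i)\<^sup>2) - CARD('m) * (\<alpha> / c)
    \<le> AL x lam c"
proof -
  have "c / (4 * \<alpha>) * (slack x lam c i)\<^sup>2 - \<alpha> / c \<le> penalty_term x lam c i (slack x lam c i)" for i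
  proof -
    define s where "s = slack x lam c i"
    define P where "P = scaling x lam i"
    have P: "0 < P" "P \<le> \<alpha>" "P * (lam $ i)\<^sup>2 \<le> \<alpha>"
      using scaling_bounds[OF x] by (simp_all add: P_def)
    have "c / (4 * \<alpha>) * s\<^sup>2 \<le> c / (4 * P) * s\<^sup>2"
      using P c by (intro mult_right_mono divide_left_mono) auto
    moreover have "P * (lam $ i)\<^sup>2 / c \<le> \<alpha> / c"
      using P c by (intro divide_right_mono) auto
    ultimately show ?thesis
      using quadratic_lower_bound[OF c P(1), of s "lam $ i"]
      by (simp add: penalty_term_def s_def P_def)
  qed
  then have "(\<Sum>i\<in>UNIV. c / (4 * \<alpha>) * (slack x lam c i)\<^sup>2 - \<alpha> / c)
      \<le> (\<Sum>i\<in>UNIV. penalty_term x lam c i (slack x lam c i))"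
    by (rule sum_mono)
  then show ?thesis
    by (simp add: AL_def sum_subtractf sum_distrib_left)
qed

lemma feasible_in_Omega:
  assumes "x \<in> feasible g I J"
  shows "x \<in> \<Omega>"
proof -
  have "max 0 (g i x) = 0" if "i \<in> I" for i
    using assms that by (auto simp: feasible_def)
  then show ?thesis
    using assms alpha_pos by (simp add: Omega_alpha_def a_fun_def b_fun_def feasible_def)
qed

text \<open>Complementarity makes every slack zero: either the multiplier is zero and the maximum is
  taken with 0, or the constraint value is zero and the shift is nonpositive.\<close>

lemma KKT_pair_AL:
  assumes "KKT_pair f g I J x lam" "c > 0"
  shows "AL x lam c = f x"
proof -
  have feas: "x \<in> feasible g I J"
    using assms by (simp add: KKT_pair_def)
  have "slack x lam c i = 0" for i
  proof (cases "i \<in> I")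
    case True
    have "lam $ i \<ge> 0" "lam $ i = 0 \<or> g i x = 0" "g i x \<le> 0"
      using assms True feas by (auto simp: KKT_pair_def feasible_def)
    moreover have "p_fun g I \<alpha> \<kappa> x lam > 0"
      using scaling_bounds(1)[OF feasible_in_Omega[OF feas], of lam i] True
      by (simp add: scaling_def)
    ultimately show ?thesis
      using True \<open>c > 0\<close>
      by (auto simp: slack_def m_fun_def max_def divide_le_0_iff mult_le_0_iff)
  next
    case False
    then show ?thesis
      using feas partition by (auto simp: slack_def feasible_def)
  qed
  then show ?thesis
    by (simp add: AL_def penalty_term_def KKT_pair_eta1[OF assms(1)])
qed

lemma optimal_value_eq:
  assumes "x \<in> optimal_solutions f g I J"
  shows "optimal_value f g I J = f x"
proof -
  have "(INF y \<in> feasible g I J. f y) = f x"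
    using assms by (intro cInf_eq_minimum) (auto simp: optimal_solutions_def)
  then show ?thesis
    by (simp add: optimal_value_def)
qed

section \<open>Existence of KKT multipliers\<close>

text \<open>Minimise the quadratic penalty function plus \<open>|x - xs|\<^sup>2\<close> over a ball around \<open>xs\<close>; LICQ
  bounds the multiplier estimates given by its stationarity condition, and their limit is the
  multiplier.\<close>

lemma KKT_exists:
  assumes opt: "xs \<in> optimal_solutions f g I J" and licq: "LICQ g I J xs"
  obtains lam where "KKT_pair f g I J xs lam"
proof -
  have feas: "xs \<in> feasible g I J" and min: "\<And>y. y \<in> feasible g I J \<Longrightarrow> f xs \<le> f y"
    using opt by (auto simp: optimal_solutions_def)
  define w where "w i t = (if i \<in> I then max 0 t else t)" for i and t :: real
  have w_deriv: "((\<lambda>t. (w i t)\<^sup>2) has_real_derivative 2 * w i t) (at t)" for i t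
  proof (cases "i \<in> I")
    case True
    then show ?thesis
      by (simp add: w_def has_real_derivative_max_0_squared)
  next
    case False
    then show ?thesis
      by (auto simp: w_def intro!: derivative_eq_intros)
  qed
  have w_cont: "isCont (w i) t" for i t
    by (cases "i \<in> I") (auto simp: w_def[abs_def] intro!: continuous_intros)
  define \<Phi> where "\<Phi> x = (\<Sum>i\<in>UNIV. (w i (g i x))\<^sup>2)" for x
  have \<Phi>_nonneg: "\<Phi> x \<ge> 0" for x
    by (simp add: \<Phi>_def sum_nonneg)
  have \<Phi>_zero: "x \<in> feasible g I J \<longleftrightarrow> \<Phi> x = 0" for x
  proof -
    have "\<Phi> x = 0 \<longleftrightarrow> (\<forall>i. w i (g i x) = 0)"
      by (simp add: \<Phi>_def sum_nonneg_eq_0_iff)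
    also have "\<dots> \<longleftrightarrow> x \<in> feasible g I J"
    proof -
      have "w i t = 0 \<longleftrightarrow> (if i \<in> I then t \<le> 0 else t = 0)" for i t
        by (auto simp: w_def max_def)
      then show ?thesis
        by (simp add: feasible_def) (metis notin_I_iff)
    qed
    finally show ?thesis ..
  qed
  \<comment> \<open>The proximal term singles out \<open>xs\<close>: other optimal solutions may lie
    in the ball, and without it the minimizers could converge to one of them.\<close>
  define F where "F k x = f x + (x - xs) \<bullet> (x - xs) + real k * \<Phi> x" for k x
  have F_deriv: "(F k has_derivative (\<lambda>h. (gradient f x + 2 *\<^sub>R (x - xs)
      + (\<Sum>i\<in>UNIV. (2 * real k * w i (g i x)) *\<^sub>R G i x)) \<bullet> h)) (at x)" for k x
  proof -
    have "((\<lambda>x. (w i (g i x))\<^sup>2) has_derivative (\<lambda>h. 2 * w i (g i x) * (G i x \<bullet> h))) (at x)" for i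
      using has_derivative_compose[OF g_deriv w_deriv[unfolded has_field_derivative_def]] by simp
    then have "(\<Phi> has_derivative (\<lambda>h. \<Sum>i\<in>UNIV. 2 * w i (g i x) * (G i x \<bullet> h))) (at x)"
      unfolding \<Phi>_def[abs_def] by (rule has_derivative_sum)
    moreover have "((\<lambda>x. (x - xs) \<bullet> (x - xs)) has_derivative (\<lambda>h. 2 * ((x - xs) \<bullet> h))) (at x)"
      by (auto intro!: derivative_eq_intros simp: inner_commute)
    ultimately have "(F k has_derivative (\<lambda>h. gradient f x \<bullet> h + 2 * ((x - xs) \<bullet> h)
        + real k * (\<Sum>i\<in>UNIV. 2 * w i (g i x) * (G i x \<bullet> h)))) (at x)"
      unfolding F_def[abs_def]
      by (intro has_derivative_add has_derivative_mult_right f_deriv)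
    then show ?thesis
      by (simp add: inner_add_left inner_sum_left sum_distrib_left mult_ac)
  qed
  have F_cont: "continuous_on A (F k)" for A k
    by (intro continuous_at_imp_continuous_on ballI has_derivative_continuous[OF F_deriv])
  have "\<exists>x \<in> cball xs 1. \<forall>y \<in> cball xs 1. F k x \<le> F k y" for k
    by (rule continuous_attains_inf[OF compact_cball _ F_cont]) simp
  then obtain X where X: "\<And>k. X k \<in> cball xs 1"
    and X_min: "\<And>k y. y \<in> cball xs 1 \<Longrightarrow> F k (X k) \<le> F k y"
    by metis
  obtain xb r where "strict_mono r" and Xr: "(X \<circ> r) \<longlonglongrightarrow> xb"
    using X compact_cball[of xs 1] unfolding compact_def by metis
  have lim: "(\<lambda>n. X (r n)) \<longlonglongrightarrow> xb"
    using Xr by (simp add: comp_def)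
  have upper: "f (X k) + (X k - xs) \<bullet> (X k - xs) + real k * \<Phi> (X k) \<le> f xs" for k
    using X_min[of xs k] feas \<Phi>_zero by (simp add: F_def)
  have f_lim: "(\<lambda>n. f (X (r n))) \<longlonglongrightarrow> f xb"
    by (rule tendsto_f[OF lim])
  have r_ge: "real n \<le> real (r n)" for n
    using seq_suble[OF \<open>strict_mono r\<close>] by simp
  have \<Phi>_lim: "(\<lambda>n. \<Phi> (X (r n))) \<longlonglongrightarrow> \<Phi> xb"
    unfolding \<Phi>_def by (intro tendsto_intros isCont_tendsto_compose[OF w_cont] tendsto_g lim)
  have "(\<lambda>n. \<Phi> (X (r n))) \<longlonglongrightarrow> 0"
  proof (rule tendsto_sandwich[where f = "\<lambda>_. 0"])
    show "\<forall>\<^sub>F n in sequentially. \<Phi> (X (r n)) \<le> (f xs - f (X (r n))) * inverse (real n)"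
    proof (rule eventually_mono[OF eventually_gt_at_top[of 0]])
      fix n :: nat assume "n > 0"
      have "real n * \<Phi> (X (r n)) \<le> real (r n) * \<Phi> (X (r n))"
        by (intro mult_right_mono r_ge \<Phi>_nonneg)
      then have "real n * \<Phi> (X (r n)) \<le> f xs - f (X (r n))"
        using upper[of "r n"] inner_ge_zero[of "X (r n) - xs"] by linarith
      then show "\<Phi> (X (r n)) \<le> (f xs - f (X (r n))) * inverse (real n)"
        using \<open>n > 0\<close> by (simp add: field_simps)
    qed
    have "(\<lambda>n. (f xs - f (X (r n))) * inverse (real n)) \<longlonglongrightarrow> (f xs - f xb) * 0"
      by (intro tendsto_intros f_lim lim_inverse_n)
    then show "(\<lambda>n. (f xs - f (X (r n))) * inverse (real n)) \<longlonglongrightarrow> 0"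
      by simp
  qed (auto simp: \<Phi>_nonneg)
  then have "\<Phi> xb = 0"
    using LIMSEQ_unique \<Phi>_lim by blast
  then have "f xs \<le> f xb"
    using min \<Phi>_zero by blast
  have "(\<lambda>n. f (X (r n)) + (X (r n) - xs) \<bullet> (X (r n) - xs)) \<longlonglongrightarrow> f xb + (xb - xs) \<bullet> (xb - xs)"
    by (intro tendsto_intros f_lim lim)
  moreover have "f (X k) + (X k - xs) \<bullet> (X k - xs) \<le> f xs" for k
    using upper[of k] \<Phi>_nonneg[of "X k"] mult_nonneg_nonneg[of "real k" "\<Phi> (X k)"] by linarith
  ultimately have "f xb + (xb - xs) \<bullet> (xb - xs) \<le> f xs"
    by (intro LIMSEQ_le_const2) auto
  then have "(xb - xs) \<bullet> (xb - xs) \<le> 0"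
    using \<open>f xs \<le> f xb\<close> by linarith
  then have "xb = xs"
    using inner_gt_zero_iff[of "xb - xs"] by (metis not_less eq_iff_diff_eq_0)
  \<comment> \<open>This is stronger than \<open>\<Phi>\<close> tending to 0; it makes the
    complementarity products of the multiplier estimates vanish in the limit.\<close>
  have k\<Phi>_lim: "(\<lambda>n. real (r n) * \<Phi> (X (r n))) \<longlonglongrightarrow> 0"
  proof (rule tendsto_sandwich[where f = "\<lambda>_. 0"])
    have "(\<lambda>n. f xs - f (X (r n))) \<longlonglongrightarrow> f xs - f xs"
      using f_lim \<open>xb = xs\<close> by (intro tendsto_intros) simp
    then show "(\<lambda>n. f xs - f (X (r n))) \<longlonglongrightarrow> 0"
      by simp
    have "real (r n) * \<Phi> (X (r n)) \<le> f xs - f (X (r n))" for n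
      using upper[of "r n"] inner_ge_zero[of "X (r n) - xs"] by linarith
    then show "\<forall>\<^sub>F n in sequentially. real (r n) * \<Phi> (X (r n)) \<le> f xs - f (X (r n))"
      by simp
  qed (auto simp: \<Phi>_nonneg)
  \<comment> \<open>These are the coefficients of the constraint gradients in the derivative of
    \<open>F (r n)\<close> at its minimizer.\<close>
  define \<mu> :: "nat \<Rightarrow> real^'m" where "\<mu> n = (\<chi> i. 2 * real (r n) * w i (g i (X (r n))))" for n
  \<comment> \<open>Gradient combination and complementarity products together: both have known
    limits, and \<open>LICQ_injective\<close> says that the pair determines the multiplier at
    \<open>xs\<close>.\<close>
  define T where "T x v = (\<Sum>i\<in>UNIV. v $ i *\<^sub>R G i x, (\<chi> i. ineq_flag i * g i x * v $ i))"
    for x and v :: "real^'m"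
  have T_lim: "(\<lambda>n. T (Y n) (V n)) \<longlonglongrightarrow> T y v" if "Y \<longlonglongrightarrow> y" "V \<longlonglongrightarrow> v" for Y y V v
    unfolding T_def by (intro tendsto_intros tendsto_vec_lambda tendsto_g tendsto_G that)
  \<comment> \<open>Only eventually: the minimizers are taken over a closed ball and must first
    enter its interior.\<close>
  have stationary: "\<forall>\<^sub>F n in sequentially. (\<Sum>i\<in>UNIV. \<mu> n $ i *\<^sub>R G i (X (r n)))
      = - (gradient f (X (r n)) + 2 *\<^sub>R (X (r n) - xs))"
  proof -
    have "\<forall>\<^sub>F n in sequentially. dist (X (r n)) xs < 1"
      using lim \<open>xb = xs\<close> tendstoD[of "\<lambda>n. X (r n)" xs sequentially 1] by simp
    then show ?thesis
    proof (rule eventually_mono)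
      fix n assume "dist (X (r n)) xs < 1"
      then have "X (r n) \<in> ball xs 1"
        by (simp add: dist_commute)
      then have "(\<lambda>h. (gradient f (X (r n)) + 2 *\<^sub>R (X (r n) - xs)
          + (\<Sum>i\<in>UNIV. (2 * real (r n) * w i (g i (X (r n)))) *\<^sub>R G i (X (r n)))) \<bullet> h) = (\<lambda>h. 0)"
        by (rule differential_zero_maxmin[OF _ open_ball F_deriv])
          (auto intro!: X_min)
      from fun_cong[OF this] have "gradient f (X (r n)) + 2 *\<^sub>R (X (r n) - xs)
          + (\<Sum>i\<in>UNIV. \<mu> n $ i *\<^sub>R G i (X (r n))) = 0"
        by (subst inner_eq_zero_iff[symmetric]) (simp add: \<mu>_def)
      then show "(\<Sum>i\<in>UNIV. \<mu> n $ i *\<^sub>R G i (X (r n)))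
          = - (gradient f (X (r n)) + 2 *\<^sub>R (X (r n) - xs))"
        by (simp only: add_eq_0_iff)
    qed
  qed
  have sum_lim: "(\<lambda>n. \<Sum>i\<in>UNIV. \<mu> n $ i *\<^sub>R G i (X (r n))) \<longlonglongrightarrow> - gradient f xs"
  proof -
    have "(\<lambda>n. - (gradient f (X (r n)) + 2 *\<^sub>R (X (r n) - xs))) \<longlonglongrightarrow> - (gradient f xs + 2 *\<^sub>R (xs - xs))"
      using lim \<open>xb = xs\<close> by (intro tendsto_intros tendsto_gradient_f) auto
    then show ?thesis
      by (subst tendsto_cong[OF stationary]) simp
  qed
  have compl_lim: "(\<lambda>n. ineq_flag i * g i (X (r n)) * \<mu> n $ i) \<longlonglongrightarrow> 0" for i
  proof -
    have bounds: "0 \<le> ineq_flag i * g i (X (r n)) * \<mu> n $ i \<and>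
        ineq_flag i * g i (X (r n)) * \<mu> n $ i \<le> 2 * (real (r n) * \<Phi> (X (r n)))" for n
    proof -
      define z where "z = g i (X (r n))"
      have "ineq_flag i * z * w i z \<le> (w i z)\<^sup>2" "0 \<le> ineq_flag i * z * w i z"
        by (auto simp: ineq_flag_def w_def max_def power2_eq_square)
      moreover have "(w i z)\<^sup>2 \<le> \<Phi> (X (r n))"
        unfolding \<Phi>_def z_def by (rule member_le_sum) auto
      ultimately have "2 * real (r n) * (ineq_flag i * z * w i z) \<le> 2 * real (r n) * \<Phi> (X (r n))"
        and "0 \<le> 2 * real (r n) * (ineq_flag i * z * w i z)"
        by (intro mult_left_mono, auto)
      then show ?thesis
        by (simp add: \<mu>_def z_def mult_ac)
    qed
    show ?thesis
    proof (rule tendsto_sandwich[where f = "\<lambda>_. 0"])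
      show "(\<lambda>n. 2 * (real (r n) * \<Phi> (X (r n)))) \<longlonglongrightarrow> 0"
        by (rule tendsto_mult_right_zero[OF k\<Phi>_lim])
    qed (use bounds in auto)
  qed
  have T_lim0: "(\<lambda>n. T (X (r n)) (\<mu> n)) \<longlonglongrightarrow> (- gradient f xs, 0)"
  proof -
    have "(\<lambda>n. \<chi> i. ineq_flag i * g i (X (r n)) * \<mu> n $ i) \<longlonglongrightarrow> (\<chi> i. 0)"
      by (intro tendsto_vec_lambda compl_lim)
    then show ?thesis
      unfolding T_def by (intro tendsto_Pair sum_lim) (simp add: zero_vec_def)
  qed
  obtain B where B: "\<And>n. norm (T (X (r n)) (\<mu> n)) \<le> B"
    using tendsto_imp_norm_bounded[OF T_lim0] by blast
  have "bounded (range \<mu>)"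
  proof (rule bounded_preimage_injective_limit[where T = "\<lambda>n. T (X (r n))" and S = "T xs", OF _ _ _ B])
    fix n c v
    show "T (X (r n)) (c *\<^sub>R v) = c *\<^sub>R T (X (r n)) v"
      by (simp add: T_def scaleR_sum_right vec_eq_iff)
  next
    fix q :: "nat \<Rightarrow> nat" and v :: "real^'m" and V assume "strict_mono q" and "V \<longlonglongrightarrow> v"
    then show "(\<lambda>n. T (X (r (q n))) (V n)) \<longlonglongrightarrow> T xs v"
      using LIMSEQ_subseq_LIMSEQ[OF lim \<open>strict_mono q\<close>] \<open>xb = xs\<close>
      by (intro T_lim) (simp_all add: comp_def)
  next
    fix v assume "T xs v = 0"
    then have sum: "(\<Sum>i\<in>UNIV. v $ i *\<^sub>R G i xs) = 0"
      and flag: "\<And>i. ineq_flag i * g i xs * v $ i = 0"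
      by (simp_all add: T_def zero_prod_def vec_eq_iff)
    have "g i xs * v $ i = 0" if "i \<in> I" for i
      using flag[of i] that by (simp add: ineq_flag_def)
    then show "v = 0"
      by (rule LICQ_injective[OF licq partition(1) sum])
  qed
  then obtain lam q where "strict_mono q" and \<mu>_lim: "(\<mu> \<circ> q) \<longlonglongrightarrow> lam"
    using bounded_imp_convergent_subsequence by blast
  have "(\<lambda>n. T (X (r (q n))) ((\<mu> \<circ> q) n)) \<longlonglongrightarrow> T xs lam"
    using LIMSEQ_subseq_LIMSEQ[OF lim \<open>strict_mono q\<close>] \<open>xb = xs\<close>
    by (intro T_lim \<mu>_lim) (simp add: comp_def)
  moreover have "(\<lambda>n. T (X (r (q n))) ((\<mu> \<circ> q) n)) \<longlonglongrightarrow> (- gradient f xs, 0)"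
    using LIMSEQ_subseq_LIMSEQ[OF T_lim0 \<open>strict_mono q\<close>] by (simp add: comp_def)
  ultimately have T_eq: "T xs lam = (- gradient f xs, 0)"
    by (rule LIMSEQ_unique)
  then have "grad_lagrangian f g xs lam = 0"
    by (simp add: T_def grad_lagrangian_eq)
  moreover have "lam $ i * g i xs = 0" if "i \<in> I" for i
    using T_eq that by (auto simp: T_def vec_eq_iff ineq_flag_def dest!: spec[of _ i])
  moreover have "lam $ i \<ge> 0" if "i \<in> I" for i
  proof (rule LIMSEQ_le_const)
    show "(\<lambda>n. (\<mu> \<circ> q) n $ i) \<longlonglongrightarrow> lam $ i"
      by (intro tendsto_intros \<mu>_lim)
    show "\<exists>N. \<forall>n\<ge>N. 0 \<le> (\<mu> \<circ> q) n $ i"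
      using that by (auto simp: \<mu>_def w_def)
  qed
  ultimately have "KKT_pair f g I J xs lam"
    using feas by (simp add: KKT_pair_def)
  then show thesis
    by (rule that)
qed

section \<open>Local exactness\<close>

text \<open>All terms on the left of \<open>key\<close> are nonnegative and share the budget
  \<open>E n * (t n)\<^sup>2\<close>, where \<open>E\<close> converges. Dividing each of them by a
  suitable power of \<open>t n\<close> gives one conclusion about \<open>h\<close> or
  \<open>v\<close>.\<close>

lemma no_descent_direction:
  assumes KKT: "KKT_pair f g I J xs lam" and licq: "LICQ g I J xs"
    and sosc: "second_order_sufficient f g I J xs lam"
    and X: "X \<longlonglongrightarrow> xs" and V: "V \<longlonglongrightarrow> lam" and C: "filterlim C at_top sequentially"
    and C_pos: "\<And>n. C n > 0" and \<Omega>: "\<And>n. X n \<in> \<Omega>"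
    and less: "\<And>n. AL (X n) (V n) (C n) < f xs"
    and t_pos: "\<And>n. t n > 0" and t_lim: "t \<longlonglongrightarrow> 0"
    and h: "(\<lambda>n. (X n - xs) /\<^sub>R t n) \<longlonglongrightarrow> h"
    and v: "(\<lambda>n. (V n - lam) /\<^sub>R t n) \<longlonglongrightarrow> v"
  shows "h = 0 \<and> v = 0"
proof -
  define s where "s n i = slack (X n) (V n) (C n) i" for n i
  define H where "H = hess_lagrangian f g xs lam"
  define A where "A n = (lagrangian f g (X n) lam - lagrangian f g xs lam) / (t n)\<^sup>2" for n
  \<comment> \<open>The budget left after the second order change of the Lagrangian; the deviation
    of the multiplier enters with the factor \<open>inverse (C n)\<close> and drops out in the
    limit.\<close>
  define E where "E n = \<alpha> * inverse (C n) * (norm ((V n - lam) /\<^sub>R t n))\<^sup>2 - A n" for n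
  have feas: "\<And>i. i \<in> I \<Longrightarrow> g i xs \<le> 0" "\<And>i. i \<notin> I \<Longrightarrow> g i xs = 0"
    and lam: "\<And>i. i \<in> I \<Longrightarrow> lam $ i \<ge> 0" "\<And>i. i \<in> I \<Longrightarrow> lam $ i * g i xs = 0"
    and stat: "grad_lagrangian f g xs lam = 0"
    using KKT notin_I_iff by (auto simp: KKT_pair_def feasible_def)
  have lam_g: "lam $ i * g i xs = 0" for i
    using feas(2)[of i] lam(2)[of i] by (cases "i \<in> I") simp_all
  have lag: "lagrangian f g xs lam = f xs"
    by (simp add: lagrangian_def lam_g)
  have A_lim: "A \<longlonglongrightarrow> h \<bullet> (H *v h) / 2"
    unfolding A_def H_def
  proof (rule second_order_limit[OF _ hess_lagrangian_works _ X t_pos h])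
    show "(\<lambda>y. lagrangian f g y lam) differentiable (at y)" for y
      using lagrangian_deriv differentiable_def by blast
    show "gradient (\<lambda>y. lagrangian f g y lam) xs = 0"
      using stat by (simp add: grad_lagrangian_def)
  qed
  have Cinv: "(\<lambda>n. inverse (C n)) \<longlonglongrightarrow> 0"
    using C by (rule tendsto_inverse_0_at_top)
  have "(\<lambda>n. \<alpha> * inverse (C n) * (norm ((V n - lam) /\<^sub>R t n))\<^sup>2 - A n)
      \<longlonglongrightarrow> \<alpha> * 0 * (norm v)\<^sup>2 - h \<bullet> (H *v h) / 2"
    by (intro tendsto_intros A_lim Cinv v)
  then have E_lim: "E \<longlonglongrightarrow> - (h \<bullet> (H *v h) / 2)"
    by (simp add: E_def[abs_def])
  have s_ge: "g i (X n) \<le> s n i" for n i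
    by (simp add: s_def slack_ge)
  have mult_nonneg: "ineq_flag i * lam $ i * (s n i - g i (X n)) \<ge> 0" for n i
    using lam(1)[of i] s_ge by (simp add: ineq_flag_def)
  have key: "C n / (4 * \<alpha>) * (\<Sum>i\<in>UNIV. (s n i)\<^sup>2)
      + (\<Sum>i\<in>UNIV. ineq_flag i * lam $ i * (s n i - g i (X n))) + \<eta> (X n) (V n)
      \<le> E n * (t n)\<^sup>2" for n
  proof -
    \<comment> \<open>Write \<open>V n\<close> as \<open>lam\<close> plus a deviation. The part with
      \<open>lam\<close> builds the Lagrangian and the complementarity gap; the deviation is
      absorbed by half of the penalty.\<close>
    have "lam $ i * g i (X n) + ineq_flag i * lam $ i * (s n i - g i (X n))
        + C n / (4 * \<alpha>) * (s n i)\<^sup>2 - \<alpha> * inverse (C n) * ((V n - lam) $ i)\<^sup>2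
        \<le> penalty_term (X n) (V n) (C n) i (slack (X n) (V n) (C n) i)" for i
    proof -
      define P where "P = scaling (X n) (V n) i"
      define d where "d = (V n - lam) $ i"
      have P: "0 < P" "P \<le> \<alpha>"
        using scaling_bounds[OF \<Omega>] by (simp_all add: P_def)
      have "C n / (4 * \<alpha>) * (s n i)\<^sup>2 \<le> C n / (4 * P) * (s n i)\<^sup>2"
        using P C_pos[of n] by (intro mult_right_mono divide_left_mono) auto
      moreover have "P * d\<^sup>2 / C n \<le> \<alpha> * inverse (C n) * d\<^sup>2"
      proof -
        have "inverse (C n) * (P * d\<^sup>2) \<le> inverse (C n) * (\<alpha> * d\<^sup>2)"
          using P C_pos[of n] by (intro mult_left_mono mult_right_mono) auto
        then show ?thesis
          by (simp only: divide_inverse mult_ac)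
      qed
      moreover have "lam $ i * g i (X n) + ineq_flag i * lam $ i * (s n i - g i (X n)) = lam $ i * s n i"
        by (cases "i \<in> I") (simp_all add: ineq_flag_def s_def slack_eq algebra_simps)
      moreover have "penalty_term (X n) (V n) (C n) i (slack (X n) (V n) (C n) i)
          = lam $ i * s n i + (d * s n i + C n / (2 * P) * (s n i)\<^sup>2)"
        by (simp add: penalty_term_def s_def P_def d_def algebra_simps)
      ultimately show ?thesis
        using quadratic_lower_bound[OF C_pos[of n] P(1), of "s n i" d]
        unfolding d_def[symmetric] by linarith
    qed
    then have "(\<Sum>i\<in>UNIV. lam $ i * g i (X n) + ineq_flag i * lam $ i * (s n i - g i (X n))
        + C n / (4 * \<alpha>) * (s n i)\<^sup>2 - \<alpha> * inverse (C n) * ((V n - lam) $ i)\<^sup>2)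
        \<le> (\<Sum>i\<in>UNIV. penalty_term (X n) (V n) (C n) i (slack (X n) (V n) (C n) i))"
      by (rule sum_mono)
    then have "lagrangian f g (X n) lam + (\<Sum>i\<in>UNIV. ineq_flag i * lam $ i * (s n i - g i (X n)))
        + C n / (4 * \<alpha>) * (\<Sum>i\<in>UNIV. (s n i)\<^sup>2)
        - \<alpha> * inverse (C n) * (norm (V n - lam))\<^sup>2 + \<eta> (X n) (V n) \<le> AL (X n) (V n) (C n)"
      unfolding norm_vec_power2 AL_def lagrangian_def sum.distrib sum_subtractf sum_distrib_left
      by linarith
    moreover have "E n * (t n)\<^sup>2 = \<alpha> * inverse (C n) * (norm (V n - lam))\<^sup>2
        - (lagrangian f g (X n) lam - f xs)"
    proof -
      have "norm ((V n - lam) /\<^sub>R t n) = norm (V n - lam) / t n"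
        using t_pos[of n] by (simp only: norm_scaleR) (simp add: divide_inverse)
      then show ?thesis
        using t_pos[of n] unfolding E_def A_def lag
        by (simp only: power_divide) (simp add: field_simps)
    qed
    ultimately show ?thesis
      using less[of n] by linarith
  qed
  have pen_nonneg: "C n / (4 * \<alpha>) * (\<Sum>i\<in>UNIV. (s n i)\<^sup>2) \<ge> 0" for n
    using C_pos[of n] alpha_pos by (simp add: sum_nonneg)
  have cmp_nonneg: "(\<Sum>i\<in>UNIV. ineq_flag i * lam $ i * (s n i - g i (X n))) \<ge> 0" for n
    by (intro sum_nonneg mult_nonneg)
  \<comment> \<open>The squared slacks carry the factor \<open>C n\<close>, so they are of smaller
    order than the budget itself.\<close>
  have s_lim: "(\<lambda>n. s n i / t n) \<longlonglongrightarrow> 0" for i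
  proof -
    have "(\<lambda>n. (s n i / t n)\<^sup>2) \<longlonglongrightarrow> 0"
    proof (rule tendsto_sandwich[where f = "\<lambda>_. 0"])
      show "\<forall>\<^sub>F n in sequentially. (s n i / t n)\<^sup>2 \<le> 4 * \<alpha> * inverse (C n) * E n"
      proof (intro always_eventually allI)
        fix n
        have "(s n i)\<^sup>2 \<le> (\<Sum>i\<in>UNIV. (s n i)\<^sup>2)"
          by (rule member_le_sum) auto
        then have "C n / (4 * \<alpha>) * (s n i)\<^sup>2 \<le> C n / (4 * \<alpha>) * (\<Sum>i\<in>UNIV. (s n i)\<^sup>2)"
          using C_pos[of n] alpha_pos by (intro mult_left_mono) auto
        then have "C n / (4 * \<alpha>) * (s n i)\<^sup>2 \<le> E n * (t n)\<^sup>2"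
          using key[of n] cmp_nonneg[of n] eta1_nonneg[of "X n" "V n"] by linarith
        then show "(s n i / t n)\<^sup>2 \<le> 4 * \<alpha> * inverse (C n) * E n"
          using C_pos[of n] alpha_pos t_pos[of n] by (simp add: field_simps)
      qed
      have "(\<lambda>n. 4 * \<alpha> * inverse (C n) * E n) \<longlonglongrightarrow> 4 * \<alpha> * 0 * - (h \<bullet> (H *v h) / 2)"
        by (intro tendsto_intros Cinv E_lim)
      then show "(\<lambda>n. 4 * \<alpha> * inverse (C n) * E n) \<longlonglongrightarrow> 0"
        by simp
    qed auto
    then have "(\<lambda>n. sqrt ((s n i / t n)\<^sup>2)) \<longlonglongrightarrow> sqrt 0"
      by (rule tendsto_real_sqrt)
    then show ?thesis
      by (simp only: real_sqrt_abs real_sqrt_zero tendsto_rabs_zero_iff)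
  qed
  have g_lim: "(\<lambda>n. g i (X n) / t n) \<longlonglongrightarrow> G i xs \<bullet> h" if "g i xs = 0" for i
    using directional_limit[OF g_deriv X t_pos h, of i] that
    by (simp add: divide_inverse mult.commute)
  have crit_ineq: "G i xs \<bullet> h \<le> 0" if "g i xs = 0" for i
    by (rule LIMSEQ_le[OF g_lim[OF that] s_lim[of i]]) (simp add: s_ge t_pos divide_right_mono less_imp_le)
  have crit_pos: "G i xs \<bullet> h = 0" if "i \<in> I" "lam $ i > 0" for i
  proof -
    have "g i xs = 0"
      using lam_g[of i] that by simp
    have lim1: "(\<lambda>n. lam $ i * (s n i / t n - g i (X n) / t n)) \<longlonglongrightarrow> lam $ i * (0 - G i xs \<bullet> h)"
      by (intro tendsto_intros s_lim g_lim) fact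
    \<comment> \<open>The gap is bounded by a multiple of \<open>(t n)\<^sup>2\<close> but is
      divided by \<open>t n\<close> only, so the bound tends to 0.\<close>
    have lim2: "(\<lambda>n. E n * t n) \<longlonglongrightarrow> - (h \<bullet> (H *v h) / 2) * 0"
      by (intro tendsto_intros E_lim t_lim)
    have "lam $ i * (s n i / t n - g i (X n) / t n) \<le> E n * t n" for n
    proof -
      have "ineq_flag i * lam $ i * (s n i - g i (X n))
          \<le> (\<Sum>i\<in>UNIV. ineq_flag i * lam $ i * (s n i - g i (X n)))"
        using mult_nonneg by (intro member_le_sum) auto
      then have "lam $ i * (s n i - g i (X n)) \<le> E n * (t n)\<^sup>2"
        using key[of n] pen_nonneg[of n] eta1_nonneg[of "X n" "V n"] that
        by (simp add: ineq_flag_def)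
      then have "lam $ i * (s n i - g i (X n)) / t n \<le> E n * (t n)\<^sup>2 / t n"
        by (intro divide_right_mono) (simp_all add: t_pos less_imp_le)
      then show ?thesis
        using t_pos[of n] by (simp add: right_diff_distrib diff_divide_distrib power2_eq_square)
    qed
    then have "lam $ i * (0 - G i xs \<bullet> h) \<le> - (h \<bullet> (H *v h) / 2) * 0"
      by (intro LIMSEQ_le[OF lim1 lim2]) auto
    then have "G i xs \<bullet> h \<ge> 0"
      using that by (simp add: zero_le_mult_iff)
    then show ?thesis
      using crit_ineq[OF \<open>g i xs = 0\<close>] by linarith
  qed
  have crit_eq: "G j xs \<bullet> h = 0" if "j \<in> J" for j
  proof -
    have "j \<notin> I"
      using that notin_I_iff by blast
    then have "(\<lambda>n. s n j / t n) \<longlonglongrightarrow> G j xs \<bullet> h"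
      using g_lim feas(2) by (simp add: s_def slack_eq)
    then show ?thesis
      using s_lim LIMSEQ_unique by blast
  qed
  have eta_le: "\<eta> (X n) (V n) / (t n)\<^sup>2 \<le> E n" for n
  proof -
    have "\<eta> (X n) (V n) \<le> E n * (t n)\<^sup>2"
      using key[of n] pen_nonneg[of n] cmp_nonneg[of n] by linarith
    then show ?thesis
      using t_pos[of n] by (simp add: divide_le_eq)
  qed
  have "0 \<le> E n" for n
    using eta_le[of n] eta1_nonneg[of "X n" "V n"] by (meson divide_nonneg_nonneg order_trans zero_le_power2)
  then have "0 \<le> - (h \<bullet> (H *v h) / 2)"
    by (intro LIMSEQ_le_const[OF E_lim]) auto
  then have "\<not> h \<bullet> (H *v h) > 0"
    by linarith
  then have "h = 0"
    using sosc crit_ineq crit_pos crit_eq unfolding second_order_sufficient_def H_def by blast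
  \<comment> \<open>With \<open>h = 0\<close> the budget has limit 0, and this in turn controls
    \<open>eta1\<close> at order \<open>(t n)\<^sup>2\<close>.\<close>
  have E_lim0: "E \<longlonglongrightarrow> 0"
    using E_lim \<open>h = 0\<close> by simp
  define S where "S = (\<Sum>j\<in>UNIV. v $ j *\<^sub>R G j xs)"
  have DL_lim: "(\<lambda>n. grad_lagrangian f g (X n) (V n) /\<^sub>R t n) \<longlonglongrightarrow> S"
  proof -
    have "(\<lambda>n. (gradient (\<lambda>y. lagrangian f g y lam) (X n) - gradient (\<lambda>y. lagrangian f g y lam) xs) /\<^sub>R t n)
        \<longlonglongrightarrow> hess_lagrangian f g xs lam *v h"
      by (rule directional_limit[OF hess_lagrangian_works X t_pos h])
    then have 1: "(\<lambda>n. grad_lagrangian f g (X n) lam /\<^sub>R t n) \<longlonglongrightarrow> 0"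
      using stat \<open>h = 0\<close> by (simp add: grad_lagrangian_def)
    have 2: "(\<lambda>n. \<Sum>j\<in>UNIV. ((V n - lam) /\<^sub>R t n) $ j *\<^sub>R G j (X n)) \<longlonglongrightarrow> S"
      unfolding S_def by (intro tendsto_intros tendsto_vec_nth v tendsto_G X)
    have "grad_lagrangian f g (X n) (V n) /\<^sub>R t n = grad_lagrangian f g (X n) lam /\<^sub>R t n
        + (\<Sum>j\<in>UNIV. ((V n - lam) /\<^sub>R t n) $ j *\<^sub>R G j (X n))" for n
    proof -
      have "grad_lagrangian f g (X n) (V n) = grad_lagrangian f g (X n) lam
          + (\<Sum>j\<in>UNIV. (V n - lam) $ j *\<^sub>R G j (X n))"
        by (simp add: grad_lagrangian_eq scaleR_diff_left sum_subtractf)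
      then show ?thesis
        by (simp add: scaleR_add_right scaleR_sum_right)
    qed
    then show ?thesis
      using tendsto_add[OF 1 2] by simp
  qed
  have "mult_map xs v $ i = 0" for i
  proof -
    \<comment> \<open>Component \<open>i\<close> of the residual in \<open>eta1\<close>, divided by
      \<open>t n\<close>. It tends to the component of \<open>mult_map xs v\<close>, while its
      square is at most \<open>E n\<close>.\<close>
    define w where "w n = (grad_lagrangian f g (X n) (V n) /\<^sub>R t n) \<bullet> G i (X n)
      + ineq_flag i * ((g i (X n))\<^sup>2 * V n $ i / t n)" for n
    have g2_lim: "(\<lambda>n. (g i (X n))\<^sup>2 * V n $ i / t n) \<longlonglongrightarrow> (g i xs)\<^sup>2 * v $ i"
    \<comment> \<open>If the constraint is active, one factor \<open>g i (X n)\<close> tends to 0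
      and the other stays bounded after division; if it is inactive, \<open>lam $ i = 0\<close> and
      the multiplier itself is the difference to be divided.\<close>
    proof (cases "g i xs = 0")
      case True
      have "(\<lambda>n. g i (X n) * V n $ i * (g i (X n) / t n)) \<longlonglongrightarrow> g i xs * lam $ i * (G i xs \<bullet> h)"
        by (intro tendsto_intros tendsto_vec_nth V tendsto_g X g_lim) fact
      then show ?thesis
        using True by (simp add: power2_eq_square mult_ac)
    next
      case False
      then have "lam $ i = 0"
        using lam_g[of i] by simp
      have "(\<lambda>n. (g i (X n))\<^sup>2 * ((V n - lam) /\<^sub>R t n) $ i) \<longlonglongrightarrow> (g i xs)\<^sup>2 * v $ i"
        by (intro tendsto_intros tendsto_vec_nth v tendsto_g X)
      then show ?thesis
        using \<open>lam $ i = 0\<close> by (simp add: divide_inverse mult_ac)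
    qed
    have w_lim: "w \<longlonglongrightarrow> mult_map xs v $ i"
      unfolding w_def mult_map_def vec_lambda_beta S_def[symmetric] mult.assoc
      by (intro tendsto_intros DL_lim g2_lim tendsto_G X)
    have "(w n)\<^sup>2 \<le> E n" for n
    proof -
      have w_eq: "w n = (grad_lagrangian f g (X n) (V n) \<bullet> G i (X n)
          + ineq_flag i * (g i (X n))\<^sup>2 * V n $ i) / t n"
        by (simp add: w_def divide_inverse algebra_simps)
      have "(grad_lagrangian f g (X n) (V n) \<bullet> G i (X n) + ineq_flag i * (g i (X n))\<^sup>2 * V n $ i)\<^sup>2
          \<le> \<eta> (X n) (V n)"
        unfolding eta1_sum by (rule member_le_sum) auto
      then have "(w n)\<^sup>2 \<le> \<eta> (X n) (V n) / (t n)\<^sup>2"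
        by (simp add: w_eq power_divide divide_right_mono)
      then show ?thesis
        using eta_le[of n] by linarith
    qed
    then have "(mult_map xs v $ i)\<^sup>2 \<le> 0"
      by (intro LIMSEQ_le[OF tendsto_power[OF w_lim] E_lim0]) auto
    then show ?thesis
      by simp
  qed
  then have "v = 0"
    using mult_map_injective[OF licq] by (simp add: vec_eq_iff)
  then show ?thesis
    using \<open>h = 0\<close> by simp
qed

lemma locally_exact:
  assumes KKT: "KKT_pair f g I J xs lam" and licq: "LICQ g I J xs"
    and sosc: "second_order_sufficient f g I J xs lam"
    and X: "X \<longlonglongrightarrow> xs" and V: "V \<longlonglongrightarrow> lam" and C: "filterlim C at_top sequentially"
    and C_pos: "\<And>n. C n > 0" and \<Omega>: "\<And>n. X n \<in> \<Omega>"
  shows "\<exists>n. AL (X n) (V n) (C n) \<ge> f xs"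
proof (rule ccontr)
  assume "\<not> ?thesis"
  then have less: "AL (X n) (V n) (C n) < f xs" for n
    by (simp add: not_le)
  define d where "d n = (X n, V n) - (xs, lam)" for n
  \<comment> \<open>At the KKT-pair the value is exactly \<open>f xs\<close>, which the strict
    inequality excludes.\<close>
  have "d n \<noteq> 0" for n
    using less[of n] KKT_pair_AL[OF KKT C_pos[of n]] by (auto simp: d_def zero_prod_def)
  then have sphere: "\<forall>n. d n /\<^sub>R norm (d n) \<in> sphere 0 1"
    by simp
  have "seq_compact (sphere (0 :: (real^'d) \<times> (real^'m)) 1)"
    by (simp add: compact_imp_seq_compact)
  then obtain u r where u: "u \<in> sphere 0 1" and r: "strict_mono (r :: nat \<Rightarrow> nat)"
    and lim: "((\<lambda>n. d n /\<^sub>R norm (d n)) \<circ> r) \<longlonglongrightarrow> u"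
    using sphere by (rule seq_compactE)
  have "(\<lambda>n. norm ((X n, V n) - (xs, lam))) \<longlonglongrightarrow> norm ((xs, lam) - (xs, lam))"
    by (intro tendsto_intros X V)
  then have t_lim: "(\<lambda>n. norm (d n)) \<longlonglongrightarrow> 0"
    by (simp add: d_def)
  have "fst u = 0 \<and> snd u = 0"
  proof (rule no_descent_direction[OF KKT licq sosc, where X = "X \<circ> r" and V = "V \<circ> r"
        and C = "C \<circ> r" and t = "(\<lambda>n. norm (d n)) \<circ> r"])
    show "(\<lambda>n. ((X \<circ> r) n - xs) /\<^sub>R ((\<lambda>n. norm (d n)) \<circ> r) n) \<longlonglongrightarrow> fst u"
      using tendsto_fst[OF lim] by (simp add: d_def comp_def)
    show "(\<lambda>n. ((V \<circ> r) n - lam) /\<^sub>R ((\<lambda>n. norm (d n)) \<circ> r) n) \<longlonglongrightarrow> snd u"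
      using tendsto_snd[OF lim] by (simp add: d_def comp_def)
    show "filterlim (C \<circ> r) at_top sequentially"
      using filterlim_compose[OF C filterlim_subseq[OF r]] by (simp add: comp_def)
  qed (use \<open>\<And>n. d n \<noteq> 0\<close> less C_pos \<Omega> LIMSEQ_subseq_LIMSEQ[OF _ r] X V t_lim in auto)
  then show False
    using u by (simp add: norm_prod_def)
qed

text \<open>Nothing is assumed about the size of \<open>V\<close>: the argument bounds it along a
  subsequence through \<open>eta1\<close>, after the limit of the points has been shown to be
  optimal.\<close>

lemma sublevel_sequence_unbounded:
  assumes opt: "xs \<in> optimal_solutions f g I J"
    and licq: "\<And>x. x \<in> optimal_solutions f g I J \<Longrightarrow> LICQ g I J x"
    and sosc: "\<And>x lam. x \<in> optimal_solutions f g I J \<Longrightarrow> KKT_pair f g I J x lam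
      \<Longrightarrow> second_order_sufficient f g I J x lam"
    and C: "filterlim C at_top sequentially"
    and C_pos: "\<And>n. C n > 0" and \<Omega>: "\<And>n. X n \<in> \<Omega>"
    and less: "\<And>n. AL (X n) (V n) (C n) < f xs"
  shows "\<not> bounded (range X)"
proof
  assume "bounded (range X)"
  then obtain xb r where r: "strict_mono (r :: nat \<Rightarrow> nat)" and "(X \<circ> r) \<longlonglongrightarrow> xb"
    using bounded_imp_convergent_subsequence by blast
  define Y W K where "Y = X \<circ> r" and "W = V \<circ> r" and "K = C \<circ> r"
  have Y: "Y \<longlonglongrightarrow> xb"
    using \<open>(X \<circ> r) \<longlonglongrightarrow> xb\<close> by (simp add: Y_def)
  have K: "filterlim K at_top sequentially" "\<And>n. K n > 0"
    using filterlim_compose[OF C filterlim_subseq[OF r]] C_pos by (simp_all add: K_def comp_def)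
  have Y\<Omega>: "Y n \<in> \<Omega>" for n
    by (simp add: Y_def \<Omega>)
  have YW: "AL (Y n) (W n) (K n) < f xs" for n
    by (simp add: Y_def W_def K_def less)
  have Kinv: "(\<lambda>n. inverse (K n)) \<longlonglongrightarrow> 0"
    using K(1) by (rule tendsto_inverse_0_at_top)
  \<comment> \<open>What \<open>AL_lower_bound\<close> leaves for \<open>eta1\<close> and the
    penalty together. Being nonnegative, it also yields \<open>f xb \<le> f xs\<close> in the
    limit.\<close>
  define e where "e n = f xs - f (Y n) + CARD('m) * (\<alpha> * inverse (K n))" for n
  define s where "s n i = slack (Y n) (W n) (K n) i" for n i
  have "(\<lambda>n. f xs - f (Y n) + CARD('m) * (\<alpha> * inverse (K n)))
      \<longlonglongrightarrow> f xs - f xb + CARD('m) * (\<alpha> * 0)"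
    by (intro tendsto_intros tendsto_f Y Kinv)
  then have e_lim: "e \<longlonglongrightarrow> f xs - f xb"
    by (simp add: e_def[abs_def])
  have pen: "\<eta> (Y n) (W n) + K n / (4 * \<alpha>) * (\<Sum>i\<in>UNIV. (s n i)\<^sup>2) \<le> e n" for n
    using AL_lower_bound[OF Y\<Omega>[of n] K(2)[of n], of "W n"] YW[of n]
    unfolding e_def s_def divide_inverse[of \<alpha>] by linarith
  have pen_nonneg: "K n / (4 * \<alpha>) * (\<Sum>i\<in>UNIV. (s n i)\<^sup>2) \<ge> 0" for n
    using K(2)[of n] alpha_pos by (simp add: sum_nonneg)
  have eta_le: "\<eta> (Y n) (W n) \<le> e n" for n
    using pen[of n] pen_nonneg[of n] by linarith
  have "0 \<le> e n" for n
    using eta_le[of n] eta1_nonneg[of "Y n" "W n"] by linarith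
  then have "0 \<le> f xs - f xb"
    by (intro LIMSEQ_le_const[OF e_lim]) auto
  have s_lim: "(\<lambda>n. s n i) \<longlonglongrightarrow> 0" for i
  proof -
    have "(\<lambda>n. (s n i)\<^sup>2) \<longlonglongrightarrow> 0"
    proof (rule tendsto_sandwich[where f = "\<lambda>_. 0"])
      show "\<forall>\<^sub>F n in sequentially. (s n i)\<^sup>2 \<le> 4 * \<alpha> * inverse (K n) * e n"
      proof (intro always_eventually allI)
        fix n
        have "(s n i)\<^sup>2 \<le> (\<Sum>i\<in>UNIV. (s n i)\<^sup>2)"
          by (rule member_le_sum) auto
        then have "K n / (4 * \<alpha>) * (s n i)\<^sup>2 \<le> K n / (4 * \<alpha>) * (\<Sum>i\<in>UNIV. (s n i)\<^sup>2)"
          using K(2)[of n] alpha_pos by (intro mult_left_mono) auto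
        then have "K n / (4 * \<alpha>) * (s n i)\<^sup>2 \<le> e n"
          using pen[of n] eta1_nonneg[of "Y n" "W n"] by linarith
        then show "(s n i)\<^sup>2 \<le> 4 * \<alpha> * inverse (K n) * e n"
          using K(2)[of n] alpha_pos by (simp add: field_simps)
      qed
      have "(\<lambda>n. 4 * \<alpha> * inverse (K n) * e n) \<longlonglongrightarrow> 4 * \<alpha> * 0 * (f xs - f xb)"
        by (intro tendsto_intros Kinv e_lim)
      then show "(\<lambda>n. 4 * \<alpha> * inverse (K n) * e n) \<longlonglongrightarrow> 0"
        by simp
    qed auto
    then have "(\<lambda>n. sqrt ((s n i)\<^sup>2)) \<longlonglongrightarrow> sqrt 0"
      by (rule tendsto_real_sqrt)
    then show ?thesis
      by (simp only: real_sqrt_abs real_sqrt_zero tendsto_rabs_zero_iff)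
  qed
  \<comment> \<open>Slacks dominate the constraint values, so vanishing slacks make the limit
    feasible.\<close>
  have "g i xb \<le> 0" for i
    by (rule LIMSEQ_le[OF tendsto_g[OF Y] s_lim[of i]]) (auto simp: s_def slack_ge)
  moreover have "g j xb = 0" if "j \<in> J" for j
  proof -
    have "j \<notin> I"
      using that notin_I_iff by blast
    then have "(\<lambda>n. s n j) \<longlonglongrightarrow> g j xb"
      using tendsto_g[OF Y] by (simp add: s_def slack_eq)
    then show ?thesis
      using s_lim LIMSEQ_unique by blast
  qed
  ultimately have feas: "xb \<in> feasible g I J"
    by (simp add: feasible_def)
  then have "f xb = f xs" and opt_xb: "xb \<in> optimal_solutions f g I J"
    using opt \<open>0 \<le> f xs - f xb\<close> by (force simp: optimal_solutions_def)+
  have licq_xb: "LICQ g I J xb"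
    using licq opt_xb by blast
  obtain Be where Be: "\<And>n. norm (e n) \<le> Be"
    using tendsto_imp_norm_bounded[OF e_lim] by blast
  \<comment> \<open>The part of the residual in \<open>eta1\<close> that is free of the multiplier;
    subtracting it turns the bound on \<open>eta1\<close> into one on
    \<open>mult_map\<close>.\<close>
  define b where "b n = (\<chi> i. gradient f (Y n) \<bullet> G i (Y n))" for n
  have b_lim: "b \<longlonglongrightarrow> (\<chi> i. gradient f xb \<bullet> G i xb)"
    unfolding b_def by (intro tendsto_vec_lambda tendsto_intros tendsto_gradient_f tendsto_G Y)
  obtain Bb where Bb: "\<And>n. norm (b n) \<le> Bb"
    using tendsto_imp_norm_bounded[OF b_lim] by blast
  have bnd: "norm (mult_map (Y n) (W n)) \<le> Bb + sqrt Be" for n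
  proof -
    have "(norm (b n + mult_map (Y n) (W n)))\<^sup>2 \<le> Be"
      using eta_le[of n] Be[of n] by (simp add: eta1_eq_norm b_def)
    then have "norm (b n + mult_map (Y n) (W n)) \<le> sqrt Be"
      by (rule real_le_rsqrt)
    then show ?thesis
      using norm_triangle_ineq4[of "b n + mult_map (Y n) (W n)" "b n"] Bb[of n] by simp
  qed
  have "bounded (range W)"
  proof (rule bounded_preimage_injective_limit[where T = "\<lambda>n. mult_map (Y n)" and S = "mult_map xb",
        OF mult_map_scaleR _ mult_map_injective[OF licq_xb] bnd])
    show "(\<lambda>n. mult_map (Y (q n)) (w n)) \<longlonglongrightarrow> mult_map xb v"
      if "strict_mono q" "w \<longlonglongrightarrow> v" for q v w
      using LIMSEQ_subseq_LIMSEQ[OF Y that(1)] that(2) by (intro tendsto_mult_map) (simp_all add: comp_def)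
  qed
  then obtain lam q where q: "strict_mono (q :: nat \<Rightarrow> nat)" and W: "(W \<circ> q) \<longlonglongrightarrow> lam"
    using bounded_imp_convergent_subsequence by blast
  have Yq: "(Y \<circ> q) \<longlonglongrightarrow> xb"
    by (rule LIMSEQ_subseq_LIMSEQ[OF Y q])
  have "\<eta> xb lam \<le> f xs - f xb"
    by (rule LIMSEQ_le[OF tendsto_eta1[OF Yq W] LIMSEQ_subseq_LIMSEQ[OF e_lim q]])
      (auto simp: eta_le)
  then have "\<eta> xb lam = 0"
    using eta1_nonneg[of xb lam] \<open>f xb = f xs\<close> by simp
  then have KKT: "KKT_pair f g I J xb lam"
    using KKT_exists[OF opt_xb licq_xb] eta1_zero_unique[OF licq_xb] KKT_pair_eta1 by metis
  have Kq: "filterlim (K \<circ> q) at_top sequentially"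
    unfolding comp_def by (rule filterlim_compose[OF K(1) filterlim_subseq[OF q]])
  have "\<exists>n. AL ((Y \<circ> q) n) ((W \<circ> q) n) ((K \<circ> q) n) \<ge> f xb"
    by (rule locally_exact[OF KKT licq_xb sosc[OF opt_xb KKT] Yq W Kq]) (simp_all add: K(2) Y\<Omega>)
  then obtain n where "AL (Y (q n)) (W (q n)) (K (q n)) \<ge> f xb"
    by auto
  then show False
    using YW[of "q n"] \<open>f xb = f xs\<close> by simp
qed

section \<open>Global exactness\<close>

lemma mem_S_e_iff:
  assumes "xs \<in> optimal_solutions f g I J"
  shows "(x, lam) \<in> S_e f g I J \<alpha> \<kappa> c \<longleftrightarrow> x \<in> \<Omega> \<and> AL x lam c < f xs"
  by (simp add: S_e_def aug_lagrangian_eq optimal_value_eq[OF assms])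

text \<open>The set \<open>B\<close> is left open so as to serve both criteria of the theorem: the
  projection of one bounded \<open>S_e\<close> to its points, and the bounded set
  \<open>Omega_sublevel\<close>.\<close>

lemma S_e_eventually_empty:
  assumes opt: "xs \<in> optimal_solutions f g I J"
    and licq: "\<And>x. x \<in> optimal_solutions f g I J \<Longrightarrow> LICQ g I J x"
    and sosc: "\<And>x lam. x \<in> optimal_solutions f g I J \<Longrightarrow> KKT_pair f g I J x lam
      \<Longrightarrow> second_order_sufficient f g I J x lam"
    and "c0 > 0" and "bounded B"
    and sub: "\<And>c x lam. c \<ge> c0 \<Longrightarrow> (x, lam) \<in> S_e f g I J \<alpha> \<kappa> c \<Longrightarrow> x \<in> B"
  shows "\<exists>c>0. S_e f g I J \<alpha> \<kappa> c = {}"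
proof (rule ccontr)
  assume "\<not> ?thesis"
  then have "\<exists>z. z \<in> S_e f g I J \<alpha> \<kappa> (c0 + real n)" for n
    using \<open>c0 > 0\<close> by (metis add_pos_nonneg all_not_in_conv of_nat_0_le_iff)
  then obtain z where z: "\<And>n. z n \<in> S_e f g I J \<alpha> \<kappa> (c0 + real n)"
    by metis
  define X V C where "X n = fst (z n)" and "V n = snd (z n)" and "C n = c0 + real n" for n
  have mem: "(X n, V n) \<in> S_e f g I J \<alpha> \<kappa> (C n)" for n
    using z by (simp add: X_def V_def C_def)
  have "\<not> bounded (range X)"
  proof (rule sublevel_sequence_unbounded[OF opt licq sosc])
    show "filterlim C at_top sequentially"
      unfolding C_def by (rule filterlim_tendsto_add_at_top[OF tendsto_const filterlim_real_sequentially])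
    show "C n > 0" for n
      using \<open>c0 > 0\<close> by (simp add: C_def add_pos_nonneg)
    show "X n \<in> \<Omega>" "AL (X n) (V n) (C n) < f xs" for n
      using mem[of n] by (simp_all add: mem_S_e_iff[OF opt])
  qed
  moreover have "range X \<subseteq> B"
    using sub[OF _ mem] by (auto simp: C_def)
  ultimately show False
    using \<open>bounded B\<close> bounded_subset by blast
qed

text \<open>The strict inequality \<open>c1 < c\<close> gives a positive coefficient to the squared
  slacks in \<open>AL_mono\<close>; a minimizer has value at most \<open>f xs\<close>, which leaves
  no room for them.\<close>

lemma aug_minimizers_eq_KKT:
  assumes opt: "xs \<in> optimal_solutions f g I J"
    and licq: "\<And>x. x \<in> optimal_solutions f g I J \<Longrightarrow> LICQ g I J x"
    and empty: "S_e f g I J \<alpha> \<kappa> c1 = {}" and c: "0 < c1" "c1 < c"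
  shows "aug_minimizers f g I J \<alpha> \<kappa> c =
    {(x, lam). x \<in> optimal_solutions f g I J \<and> KKT_pair f g I J x lam}"
proof -
  have lower1: "f xs \<le> AL x lam c1" if "x \<in> \<Omega>" for x lam
    using empty mem_S_e_iff[OF opt, of x lam c1] that by auto
  have at_KKT: "aug_lagrangian f g I J \<alpha> \<kappa> x lam c = ereal (f xs)"
    if "x \<in> optimal_solutions f g I J" "KKT_pair f g I J x lam" for x lam
  proof -
    have "f x = f xs"
      using that(1) opt by (auto simp: optimal_solutions_def intro: antisym)
    moreover have "x \<in> \<Omega>"
      using that(1) feasible_in_Omega by (simp add: optimal_solutions_def)
    ultimately show ?thesis
      using KKT_pair_AL[OF that(2), of c] c by (simp add: aug_lagrangian_eq)
  qed
  have lower: "ereal (f xs) \<le> aug_lagrangian f g I J \<alpha> \<kappa> x lam c" for x lam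
  proof (cases "x \<in> \<Omega>")
    case True
    have "0 \<le> (c - c1) / (2 * \<alpha>) * (\<Sum>i\<in>UNIV. (slack x lam c i)\<^sup>2)"
      using c alpha_pos by (simp add: sum_nonneg)
    then have "AL x lam c1 \<le> AL x lam c"
      using AL_mono[OF True c(1), of c lam] c by linarith
    then show ?thesis
      using True lower1[OF True, of lam] by (simp add: aug_lagrangian_eq)
  qed (simp add: aug_lagrangian_eq)
  have "x \<in> optimal_solutions f g I J \<and> KKT_pair f g I J x lam"
    if min: "(x, lam) \<in> aug_minimizers f g I J \<alpha> \<kappa> c" for x lam
  proof -
    obtain \<mu> where "KKT_pair f g I J xs \<mu>"
      using KKT_exists[OF opt licq[OF opt]] .
    then have "aug_lagrangian f g I J \<alpha> \<kappa> x lam c \<le> ereal (f xs)"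
      using min at_KKT[OF opt] by (metis (no_types, lifting) aug_minimizers_def case_prodD mem_Collect_eq)
    then have x: "x \<in> \<Omega>" and le: "AL x lam c \<le> f xs"
      by (auto simp: aug_lagrangian_eq split: if_splits)
    have "(c - c1) / (2 * \<alpha>) * (\<Sum>i\<in>UNIV. (slack x lam c i)\<^sup>2) \<le> 0"
      using AL_mono[OF x c(1), of c lam] c le lower1[OF x, of lam] by linarith
    then have "(\<Sum>i\<in>UNIV. (slack x lam c i)\<^sup>2) \<le> 0"
      using c alpha_pos by (simp add: mult_le_0_iff divide_le_0_iff)
    then have "(\<Sum>i\<in>UNIV. (slack x lam c i)\<^sup>2) = 0"
      by (intro antisym sum_nonneg) auto
    then have slack0: "slack x lam c i = 0" for i
      by (simp add: sum_nonneg_eq_0_iff)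
    have "g i x \<le> 0" for i
      using slack_ge[of i x lam c] slack0 by simp
    moreover have "g j x = 0" if "j \<in> J" for j
      using slack_eq[of j x lam c] slack0 that notin_I_iff by simp
    ultimately have feas: "x \<in> feasible g I J"
      by (simp add: feasible_def)
    then have "f xs \<le> f x"
      using opt by (simp add: optimal_solutions_def)
    \<comment> \<open>With zero slacks only \<open>f\<close> and \<open>eta1\<close> remain, so
      optimality of the value splits into optimality of \<open>x\<close> and a zero of
      \<open>eta1\<close>.\<close>
    moreover have "AL x lam c = f x + \<eta> x lam"
      by (simp add: AL_def penalty_term_def slack0)
    ultimately have "f x = f xs" and eta0: "\<eta> x lam = 0"
      using le eta1_nonneg[of x lam] by linarith+
    then have opt_x: "x \<in> optimal_solutions f g I J"
      using feas opt by (simp add: optimal_solutions_def)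
    then show ?thesis
      using KKT_exists[OF opt_x licq[OF opt_x]] eta1_zero_unique[OF licq[OF opt_x] eta0] KKT_pair_eta1
      by metis
  qed
  moreover have "(x, lam) \<in> aug_minimizers f g I J \<alpha> \<kappa> c"
    if "x \<in> optimal_solutions f g I J" "KKT_pair f g I J x lam" for x lam
    using at_KKT[OF that] lower by (simp add: aug_minimizers_def)
  ultimately show ?thesis
    by auto
qed

lemma globally_exact_iff_S_e_empty:
  assumes opt: "xs \<in> optimal_solutions f g I J"
    and licq: "\<And>x. x \<in> optimal_solutions f g I J \<Longrightarrow> LICQ g I J x"
  shows "globally_exact f g I J \<alpha> \<kappa> \<longleftrightarrow> (\<exists>c>0. S_e f g I J \<alpha> \<kappa> c = {})"
proof
  obtain \<mu> where KKT: "KKT_pair f g I J xs \<mu>"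
    using KKT_exists[OF opt licq[OF opt]] .
  {
    assume "globally_exact f g I J \<alpha> \<kappa>"
    then obtain c where "c > 0" and c: "(xs, \<mu>) \<in> aug_minimizers f g I J \<alpha> \<kappa> c"
      using opt KKT_pair_eta1[OF KKT] unfolding globally_exact_def by blast
    have "xs \<in> \<Omega>"
      using opt feasible_in_Omega by (simp add: optimal_solutions_def)
    then have "aug_lagrangian f g I J \<alpha> \<kappa> xs \<mu> c = ereal (f xs)"
      using KKT_pair_AL[OF KKT \<open>c > 0\<close>] by (simp add: aug_lagrangian_eq)
    then have "S_e f g I J \<alpha> \<kappa> c = {}"
      using c by (auto simp: S_e_def optimal_value_eq[OF opt] aug_minimizers_def not_less)
    then show "\<exists>c>0. S_e f g I J \<alpha> \<kappa> c = {}"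
      using \<open>c > 0\<close> by blast
  next
    assume "\<exists>c>0. S_e f g I J \<alpha> \<kappa> c = {}"
    then obtain c1 where "c1 > 0" and empty: "S_e f g I J \<alpha> \<kappa> c1 = {}"
      by blast
    have eta0_iff: "\<eta> x lam = 0 \<longleftrightarrow> KKT_pair f g I J x lam"
      if "x \<in> optimal_solutions f g I J" for x lam
      using KKT_exists[OF that licq[OF that]] eta1_zero_unique[OF licq[OF that]] KKT_pair_eta1
      by metis
    \<comment> \<open>The shift by 1 places every admissible \<open>c\<close> strictly above
      \<open>c1\<close>.\<close>
    have "aug_minimizers f g I J \<alpha> \<kappa> c =
        {(x, lam). x \<in> optimal_solutions f g I J \<and> KKT_pair f g I J x lam}" if "c \<ge> c1 + 1" for c
      using that \<open>c1 > 0\<close> by (intro aug_minimizers_eq_KKT[OF opt licq empty]) auto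
    then show "globally_exact f g I J \<alpha> \<kappa>"
      unfolding globally_exact_def using \<open>c1 > 0\<close> opt KKT eta0_iff
      by (intro exI[of _ "c1 + 1"]) auto
  }
qed

text \<open>\<open>AL_lower_bound\<close> shows that the augmented Lagrangian can fall below
  \<open>f\<close> by at most \<open>CARD('m) * (\<alpha> / c)\<close>, which is the allowance
  \<open>\<gamma>\<close>.\<close>

lemma S_e_subset_Omega_sublevel:
  assumes opt: "xs \<in> optimal_solutions f g I J"
    and mem: "(x, lam) \<in> S_e f g I J \<alpha> \<kappa> c" and c: "c > 0" "CARD('m) * (\<alpha> / c) \<le> \<gamma>"
  shows "x \<in> Omega_sublevel f g I J \<gamma> \<alpha> \<kappa>"
proof -
  have x: "x \<in> \<Omega>" and "AL x lam c < f xs"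
    using mem mem_S_e_iff[OF opt] by auto
  moreover have "0 \<le> c / (4 * \<alpha>) * (\<Sum>i\<in>UNIV. (slack x lam c i)\<^sup>2)"
    using c alpha_pos by (simp add: sum_nonneg)
  ultimately have "f x < f xs + \<gamma>"
    using AL_lower_bound[OF x c(1), of lam] eta1_nonneg[of x lam] c(2) by linarith
  then show ?thesis
    using x by (simp add: Omega_sublevel_def Omega_alpha_def optimal_value_eq[OF opt])
qed

lemma S_e_antimono:
  assumes opt: "xs \<in> optimal_solutions f g I J" and c: "0 < c'" "c' \<le> c"
  shows "S_e f g I J \<alpha> \<kappa> c \<subseteq> S_e f g I J \<alpha> \<kappa> c'"
proof clarify
  fix x lam assume "(x, lam) \<in> S_e f g I J \<alpha> \<kappa> c"
  then have x: "x \<in> \<Omega>" and "AL x lam c < f xs"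
    using mem_S_e_iff[OF opt] by auto
  moreover have "0 \<le> (c - c') / (2 * \<alpha>) * (\<Sum>i\<in>UNIV. (slack x lam c i)\<^sup>2)"
    using c alpha_pos by (simp add: sum_nonneg)
  ultimately have "AL x lam c' < f xs"
    using AL_mono[OF x c, of lam] by linarith
  then show "(x, lam) \<in> S_e f g I J \<alpha> \<kappa> c'"
    using x mem_S_e_iff[OF opt] by blast
qed

end

theorem theorem9:
  fixes f :: "real^'d \<Rightarrow> real"
    and g :: "'m::finite \<Rightarrow> real^'d \<Rightarrow> real"
    and I J :: "'m set"
    and \<alpha> \<kappa> :: real
  assumes partition: "I \<union> J = UNIV" "I \<inter> J = {}"
    and "\<alpha> > 0" "\<kappa> > 2"
    and smooth: "twice_cont_diff f" "\<And>i. twice_cont_diff (g i)"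
    and solvable: "optimal_solutions f g I J \<noteq> {}"
    and licq: "\<And>x. x \<in> optimal_solutions f g I J \<Longrightarrow> LICQ g I J x"
    and sosc: "\<And>x lam. x \<in> optimal_solutions f g I J \<Longrightarrow> KKT_pair f g I J x lam
                 \<Longrightarrow> second_order_sufficient f g I J x lam"
  shows "(globally_exact f g I J \<alpha> \<kappa> \<longleftrightarrow>
            (\<exists>c0>0. bounded (S_e f g I J \<alpha> \<kappa> c0) \<or> S_e f g I J \<alpha> \<kappa> c0 = {})) \<and>
         ((\<exists>\<gamma>>0. bounded (Omega_sublevel f g I J \<gamma> \<alpha> \<kappa>)) \<longrightarrow>
            globally_exact f g I J \<alpha> \<kappa> \<and>
            (\<exists>c0>0. \<forall>c\<ge>c0. aug_minimizers f g I J \<alpha> \<kappa> c =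
               {(x, lam). x \<in> optimal_solutions f g I J \<and> KKT_pair f g I J x lam}))"
proof -
  interpret nonlinear_program f g I J \<alpha> \<kappa>
    using partition \<open>\<alpha> > 0\<close> smooth by unfold_locales
  obtain xs where opt: "xs \<in> optimal_solutions f g I J"
    using solvable by blast
  note exact_iff = globally_exact_iff_S_e_empty[OF opt licq]
  have "globally_exact f g I J \<alpha> \<kappa>"
    if "c0 > 0" and bnd: "bounded (S_e f g I J \<alpha> \<kappa> c0)" for c0
  proof -
    \<comment> \<open>As \<open>S_e\<close> shrinks when \<open>c\<close> grows, the projection at
      \<open>c0\<close> contains the points of all later sets.\<close>
    have "x \<in> fst ` S_e f g I J \<alpha> \<kappa> c0"
      if "c \<ge> c0" and "(x, lam) \<in> S_e f g I J \<alpha> \<kappa> c" for c x lam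
      using S_e_antimono[OF opt \<open>c0 > 0\<close> that(1)] that(2) by force
    then show ?thesis
      using S_e_eventually_empty[OF opt licq sosc \<open>c0 > 0\<close> bounded_fst[OF bnd]] exact_iff
      by blast
  qed
  then have part1: "globally_exact f g I J \<alpha> \<kappa> \<longleftrightarrow>
      (\<exists>c0>0. bounded (S_e f g I J \<alpha> \<kappa> c0) \<or> S_e f g I J \<alpha> \<kappa> c0 = {})"
    using exact_iff by (metis bounded_empty)
  have "\<exists>c>0. S_e f g I J \<alpha> \<kappa> c = {}"
    if "\<gamma> > 0" and bnd: "bounded (Omega_sublevel f g I J \<gamma> \<alpha> \<kappa>)" for \<gamma>
  proof -
    \<comment> \<open>The parameter at which the loss \<open>CARD('m) * (\<alpha> / c)\<close>
      equals \<open>\<gamma>\<close>.\<close>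
    define c0 where "c0 = CARD('m) * \<alpha> / \<gamma>"
    have "c0 > 0"
      using \<open>\<alpha> > 0\<close> \<open>\<gamma> > 0\<close> by (simp add: c0_def)
    have "x \<in> Omega_sublevel f g I J \<gamma> \<alpha> \<kappa>"
      if "c \<ge> c0" and "(x, lam) \<in> S_e f g I J \<alpha> \<kappa> c" for c x lam
    proof (rule S_e_subset_Omega_sublevel[OF opt that(2)])
      show "c > 0"
        using that \<open>c0 > 0\<close> by linarith
      then show "CARD('m) * (\<alpha> / c) \<le> \<gamma>"
        using that(1) \<open>\<gamma> > 0\<close> by (simp add: c0_def field_simps)
    qed
    then show ?thesis
      using S_e_eventually_empty[OF opt licq sosc \<open>c0 > 0\<close> bnd] by blast
  qed
  moreover have "\<exists>c0>0. \<forall>c\<ge>c0. aug_minimizers f g I J \<alpha> \<kappa> c =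
      {(x, lam). x \<in> optimal_solutions f g I J \<and> KKT_pair f g I J x lam}"
    if "c1 > 0" "S_e f g I J \<alpha> \<kappa> c1 = {}" for c1
    using aug_minimizers_eq_KKT[OF opt licq that(2,1)] that(1)
    by (intro exI[of _ "c1 + 1"]) auto
  ultimately show ?thesis
    using part1 exact_iff by blast
qed

end
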